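(* For every integer $u\ge1$ and every partition $\mu$, $$D_{u,0}\,s_\mu\Big[\frac{X}{1-q}\Big]=\Big(1-(1-q^{-u})(1-q^u)\,B_\mu(q^u,q^{-u})\Big)\,s_\mu\Big[\frac{X}{1-q}\Big].$$
   Context: Let $\Lambda$ be the ring of symmetric functions in $X=x_1+x_2+\cdots$ over $\mathbb{Q}(q)$, with plethystic notation: $p_k[E]$ replaces every variable in $E$ (including $q$ and an auxiliary $z$) by its $k$-th power, $F[E]$ substitutes $p_k\mapsto p_k[E]$ (e.g. $p_k[X/(1-q)]=p_k[X]/(1-q^k)$), and $\Omega[E]=\exp(\sum_{k\ge1}p_k[E]/k)$. For an integer $u$, $[u]_q=(1-q^u)/(1-q)$; $t=1/q$, $[u]_t=(1-q^{-u})/(1-q^{-1})$, $M=(1-t)(1-q)$. For integers $u,v$, $D_{u,v}F[X]=F[X+M[u]_q/z]\,\Omega[-z[u]_tX]\big|_{z^v}$ (coefficient of $z^v$). For a partition $\mu=(\mu_1\ge\mu_2\ge\cdots\ge\mu_\ell>0)$, $B_\mu(q,t)=\sum_{i=1}^{\ell}t^{i-1}(1+q+\cdots+q^{\mu_i-1})$. *)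

theory Defs
  imports
    "HOL-Library.Multiset"
    "HOL-Library.Poly_Mapping"
    "HOL-Computational_Algebra.Formal_Laurent_Series"
    "HOL-Computational_Algebra.Field_as_Ring"
    "HOL-Computational_Algebra.Polynomial_Factorial"
    "Jordan_Normal_Form.Determinant"
begin

section \<open>The ground field of rational functions in q\<close>

type_synonym ratfun = "rat poly fract"

definition qvar :: ratfun where
  "qvar = Fract (monom 1 1) 1"

definition tvar :: ratfun where
  "tvar = 1 / qvar"

text \<open>The substitution of \<open>q ^ k\<close> for \<open>q\<close>; only \<open>k > 0\<close> is meaningful.\<close>

definition raise_q :: "nat \<Rightarrow> ratfun \<Rightarrow> ratfun" where
  "raise_q k f = (case quot_of_fract f of (a, b) \<Rightarrow>
     Fract (pcompose a (monom 1 k)) (pcompose b (monom 1 k)))"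

lemma raise_q_0 [simp]: "raise_q k 0 = 0"
  by (simp add: raise_q_def fract_collapse)


section \<open>The ring of symmetric functions\<close>

text \<open>
  A monomial in \<open>x\<^sub>0, x\<^sub>1, x\<^sub>2, \<dots>\<close> is the multiset of the indices of its variables.  A symmetric
  function is a formal series in the variables, given by its coefficients, that has bounded degree
  and is invariant under all permutations of the variables.
\<close>

typedef symfun =
  "{f :: nat multiset \<Rightarrow> ratfun.
     (\<exists>d. \<forall>m. f m \<noteq> 0 \<longrightarrow> size m \<le> d) \<and>
     (\<forall>\<pi> m. bij \<pi> \<longrightarrow> f (image_mset \<pi> m) = f m)}"
  morphisms coeff_sf Abs_symfun
  by (rule exI[of _ "\<lambda>_. 0"]) simp

setup_lifting type_definition_symfun

lemma finite_sub_mset: "finite {a. a \<subseteq># (m :: 'a multiset)}"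
proof (induction m)
  case (add x m)
  have "{a. a \<subseteq># add_mset x m} \<subseteq> {a. a \<subseteq># m} \<union> add_mset x ` {a. a \<subseteq># m}"
  proof
    fix a assume "a \<in> {a. a \<subseteq># add_mset x m}"
    hence a: "a \<subseteq># add_mset x m" by simp
    show "a \<in> {a. a \<subseteq># m} \<union> add_mset x ` {a. a \<subseteq># m}"
    proof (cases "x \<in># a")
      case True
      then obtain b where "a = add_mset x b" by (metis mset_add)
      with a show ?thesis by auto
    next
      case False
      hence "a - {#x#} = a" by simp
      with a have "a \<subseteq># m"
        by (metis add_mset_remove_trivial diff_subset_eq_self mset_subset_eq_add_mset_cancel
            subset_eq_diff_conv add_mset_add_single)
      thus ?thesis by simp
    qed
  qed
  thus ?case using add by (meson finite_UnI finite_imageI finite_subset)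
qed simp

lemma finite_mset_splits: "finite {(a, b). a + b = (m :: 'a multiset)}"
proof (rule finite_subset)
  show "{(a, b). a + b = m} \<subseteq> {a. a \<subseteq># m} \<times> {a. a \<subseteq># m}"
    by auto
qed (simp add: finite_sub_mset)

lemma mset_splits_image:
  assumes "bij \<pi>"
  shows "bij_betw (map_prod (image_mset \<pi>) (image_mset \<pi>))
           {(a, b). a + b = m} {(a, b). a + b = image_mset \<pi> m}"
proof (rule bij_betw_byWitness[where f' = "map_prod (image_mset (inv_into UNIV \<pi>)) (image_mset (inv_into UNIV \<pi>))"])
  have inv: "image_mset (inv_into UNIV \<pi>) (image_mset \<pi> a) = a"
    "image_mset \<pi> (image_mset (inv_into UNIV \<pi>) b) = b" for a b
    using assms by (simp_all add: multiset.map_comp o_def bij_is_inj bij_is_surj surj_f_inv_f)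
  show "map_prod (image_mset (inv_into UNIV \<pi>)) (image_mset (inv_into UNIV \<pi>)) ` {(a, b). a + b = image_mset \<pi> m}
          \<subseteq> {(a, b). a + b = m}"
    by (auto simp: inv simp flip: image_mset_union)
qed (use assms in \<open>auto simp: multiset.map_comp o_def bij_is_inj bij_is_surj surj_f_inv_f\<close>)

instantiation symfun :: comm_ring_1
begin

lift_definition zero_symfun :: symfun is "\<lambda>_. 0" by simp

lift_definition one_symfun :: symfun is "\<lambda>m. if m = {#} then 1 else 0" by auto

lift_definition plus_symfun :: "symfun \<Rightarrow> symfun \<Rightarrow> symfun" is "\<lambda>f g m. f m + g m"
proof (intro conjI)
  fix f g :: "nat multiset \<Rightarrow> ratfun"
  assume f: "(\<exists>d. \<forall>m. f m \<noteq> 0 \<longrightarrow> size m \<le> d) \<and> (\<forall>\<pi> m. bij \<pi> \<longrightarrow> f (image_mset \<pi> m) = f m)"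
     and g: "(\<exists>d. \<forall>m. g m \<noteq> 0 \<longrightarrow> size m \<le> d) \<and> (\<forall>\<pi> m. bij \<pi> \<longrightarrow> g (image_mset \<pi> m) = g m)"
  from f g obtain d e where "\<And>m. f m \<noteq> 0 \<Longrightarrow> size m \<le> d" "\<And>m. g m \<noteq> 0 \<Longrightarrow> size m \<le> e"
    by blast
  hence "\<forall>m. f m + g m \<noteq> 0 \<longrightarrow> size m \<le> max d e"
    by (metis add.right_neutral max.coboundedI1 max.coboundedI2)
  thus "\<exists>d. \<forall>m. f m + g m \<noteq> 0 \<longrightarrow> size m \<le> d" by blast
  show "\<forall>\<pi> m. bij \<pi> \<longrightarrow> f (image_mset \<pi> m) + g (image_mset \<pi> m) = f m + g m"
    using f g by simp
qed

lift_definition uminus_symfun :: "symfun \<Rightarrow> symfun" is "\<lambda>f m. - f m" by simp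

definition minus_symfun :: "symfun \<Rightarrow> symfun \<Rightarrow> symfun" where
  "minus_symfun f g = f + - g"

lift_definition times_symfun :: "symfun \<Rightarrow> symfun \<Rightarrow> symfun" is
  "\<lambda>f g m. \<Sum>(a, b) | a + b = m. f a * g b"
proof (intro conjI)
  fix f g :: "nat multiset \<Rightarrow> ratfun"
  assume f: "(\<exists>d. \<forall>m. f m \<noteq> 0 \<longrightarrow> size m \<le> d) \<and> (\<forall>\<pi> m. bij \<pi> \<longrightarrow> f (image_mset \<pi> m) = f m)"
     and g: "(\<exists>d. \<forall>m. g m \<noteq> 0 \<longrightarrow> size m \<le> d) \<and> (\<forall>\<pi> m. bij \<pi> \<longrightarrow> g (image_mset \<pi> m) = g m)"
  from f g obtain d e where de: "\<And>m. f m \<noteq> 0 \<Longrightarrow> size m \<le> d" "\<And>m. g m \<noteq> 0 \<Longrightarrow> size m \<le> e"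
    by blast
  have "size m \<le> d + e" if "(\<Sum>(a, b) | a + b = m. f a * g b) \<noteq> 0" for m
  proof -
    from that obtain a b where "a + b = m" "f a * g b \<noteq> 0"
      by (auto elim!: sum.not_neutral_contains_not_neutral)
    with de[of a] de[of b] show ?thesis by auto
  qed
  thus "\<exists>d. \<forall>m. (\<Sum>(a, b) | a + b = m. f a * g b) \<noteq> 0 \<longrightarrow> size m \<le> d" by blast
  show "\<forall>\<pi> m. bij \<pi> \<longrightarrow>
     (\<Sum>(a, b) | a + b = image_mset \<pi> m. f a * g b) = (\<Sum>(a, b) | a + b = m. f a * g b)"
  proof (intro allI impI)
    fix \<pi> :: "nat \<Rightarrow> nat" and m assume \<pi>: "bij \<pi>"
    show "(\<Sum>(a, b) | a + b = image_mset \<pi> m. f a * g b) = (\<Sum>(a, b) | a + b = m. f a * g b)"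
      by (subst sum.reindex_bij_betw[OF mset_splits_image[OF \<pi>], symmetric], rule sum.cong)
         (use f g \<pi> in auto)
  qed
qed

instance
proof
  fix f g h :: symfun
  show "f * g * h = f * (g * h)"
  proof transfer
    fix f g h :: "nat multiset \<Rightarrow> ratfun"
    show "(\<lambda>m. \<Sum>(a, b) | a + b = m. (\<Sum>(c, d) | c + d = a. f c * g d) * h b) =
          (\<lambda>m. \<Sum>(a, b) | a + b = m. f a * (\<Sum>(c, d) | c + d = b. g c * h d))"
    proof
      fix m
      have "(\<Sum>(a, b) | a + b = m. (\<Sum>(c, d) | c + d = a. f c * g d) * h b) =
            (\<Sum>((a, b), (c, d)) \<in> Sigma {(a, b). a + b = m} (\<lambda>(a, b). {(c, d). c + d = a}).
               f c * g d * h b)"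
        by (subst sum.Sigma[symmetric])
           (auto simp: finite_mset_splits sum_distrib_right intro!: sum.cong)
      also have "\<dots> = (\<Sum>((a, b), (c, d)) \<in> Sigma {(a, b). a + b = m} (\<lambda>(a, b). {(c, d). c + d = b}).
               f a * (g c * h d))"
        by (rule sum.reindex_bij_witness[where
              j = "\<lambda>((a, b), (c, d)). ((c, d + b), (d, b))" and
              i = "\<lambda>((a, b), (c, d)). ((a + c, d), (a, c))"])
           (auto simp: add_ac mult_ac)
      also have "\<dots> = (\<Sum>(a, b) | a + b = m. f a * (\<Sum>(c, d) | c + d = b. g c * h d))"
        by (subst sum.Sigma[symmetric])
           (auto simp: finite_mset_splits sum_distrib_left intro!: sum.cong)
      finally show "(\<Sum>(a, b) | a + b = m. (\<Sum>(c, d) | c + d = a. f c * g d) * h b) =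
                    (\<Sum>(a, b) | a + b = m. f a * (\<Sum>(c, d) | c + d = b. g c * h d))" .
    qed
  qed
  show "f * g = g * f"
  proof transfer
    fix f g :: "nat multiset \<Rightarrow> ratfun"
    show "(\<lambda>m. \<Sum>(a, b) | a + b = m. f a * g b) = (\<lambda>m. \<Sum>(a, b) | a + b = m. g a * f b)"
      by (rule ext, rule sum.reindex_bij_witness[where i = prod.swap and j = prod.swap])
         (auto simp: add_ac mult_ac)
  qed
  show "1 * f = f"
  proof transfer
    fix f :: "nat multiset \<Rightarrow> ratfun"
    show "(\<lambda>m. \<Sum>(a, b) | a + b = m. (if a = {#} then 1 else 0) * f b) = f"
    proof
      fix m
      have "(\<Sum>(a, b) | a + b = m. (if a = {#} then 1 else 0) * f b) =
            (\<Sum>(a, b) \<in> {({#} :: nat multiset, m)}. (if a = {#} then 1 else 0) * f b)"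
        by (intro sum.mono_neutral_right finite_mset_splits) (auto split: if_splits)
      thus "(\<Sum>(a, b) | a + b = m. (if a = {#} then 1 else 0) * f b) = f m" by simp
    qed
  qed
  show "(f + g) * h = f * h + g * h"
    by transfer (auto simp: fun_eq_iff ring_distribs sum.distrib case_prod_unfold)
  show "f + g + h = f + (g + h)" by transfer (simp add: add_ac)
  show "f + g = g + f" by transfer (simp add: add_ac)
  show "0 + f = f" by transfer simp
  show "- f + f = 0" by transfer simp
  show "f - g = f + - g" by (simp add: minus_symfun_def)
  show "(0::symfun) \<noteq> 1" by transfer (auto simp: fun_eq_iff)
qed

end

definition const_sf :: "ratfun \<Rightarrow> symfun" where
  "const_sf c = Abs_symfun (\<lambda>m. if m = {#} then c else 0)"

lemma coeff_const_sf [simp]: "coeff_sf (const_sf c) m = (if m = {#} then c else 0)"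
  unfolding const_sf_def by (subst Abs_symfun_inverse) auto

text \<open>Every variable, including \<open>q\<close>, is replaced by its \<open>k\<close>-th power; only \<open>k > 0\<close> is meaningful.\<close>

lift_definition raise_sf :: "nat \<Rightarrow> symfun \<Rightarrow> symfun" is
  "\<lambda>k f m. \<Sum>m' | m' \<subseteq># m \<and> repeat_mset k m' = m. raise_q k (f m')"
proof (intro conjI)
  fix k and f :: "nat multiset \<Rightarrow> ratfun"
  assume f: "(\<exists>d. \<forall>m. f m \<noteq> 0 \<longrightarrow> size m \<le> d) \<and> (\<forall>\<pi> m. bij \<pi> \<longrightarrow> f (image_mset \<pi> m) = f m)"
  then obtain d where d: "\<And>m. f m \<noteq> 0 \<Longrightarrow> size m \<le> d" by blast
  have "size m \<le> k * d"
    if "(\<Sum>m' | m' \<subseteq># m \<and> repeat_mset k m' = m. raise_q k (f m')) \<noteq> 0" for m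
  proof -
    from that obtain m' where "repeat_mset k m' = m" "raise_q k (f m') \<noteq> 0"
      by (auto elim!: sum.not_neutral_contains_not_neutral)
    with d[of m'] show ?thesis by (cases "f m' = 0") auto
  qed
  thus "\<exists>d. \<forall>m. (\<Sum>m' | m' \<subseteq># m \<and> repeat_mset k m' = m. raise_q k (f m')) \<noteq> 0 \<longrightarrow> size m \<le> d"
    by blast
  show "\<forall>\<pi> m. bij \<pi> \<longrightarrow>
     (\<Sum>m' | m' \<subseteq># image_mset \<pi> m \<and> repeat_mset k m' = image_mset \<pi> m. raise_q k (f m')) =
     (\<Sum>m' | m' \<subseteq># m \<and> repeat_mset k m' = m. raise_q k (f m'))"
  proof (intro allI impI)
    fix \<pi> :: "nat \<Rightarrow> nat" and m assume \<pi>: "bij \<pi>"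
    have inv: "image_mset (inv_into UNIV \<pi>) (image_mset \<pi> a) = a"
    "image_mset \<pi> (image_mset (inv_into UNIV \<pi>) b) = b" for a b
      using \<pi> by (simp_all add: multiset.map_comp o_def bij_is_inj bij_is_surj surj_f_inv_f)
    have rep: "repeat_mset k (image_mset \<rho> a) = image_mset \<rho> (repeat_mset k a)"
      for \<rho> :: "nat \<Rightarrow> nat" and a
      by (induction k) auto
    show "(\<Sum>m' | m' \<subseteq># image_mset \<pi> m \<and> repeat_mset k m' = image_mset \<pi> m. raise_q k (f m')) =
     (\<Sum>m' | m' \<subseteq># m \<and> repeat_mset k m' = m. raise_q k (f m'))"
    proof (rule sum.reindex_bij_witness[where i = "image_mset \<pi>" and j = "image_mset (inv_into UNIV \<pi>)"])
      fix a assume "a \<in> {m'. m' \<subseteq># image_mset \<pi> m \<and> repeat_mset k m' = image_mset \<pi> m}"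
      hence a: "a \<subseteq># image_mset \<pi> m" "repeat_mset k a = image_mset \<pi> m" by auto
      show "image_mset (inv_into UNIV \<pi>) a \<in> {m'. m' \<subseteq># m \<and> repeat_mset k m' = m}"
        using image_mset_subseteq_mono[OF a(1), of "inv_into UNIV \<pi>"] a(2) by (simp add: inv rep)
      show "raise_q k (f (image_mset (inv_into UNIV \<pi>) a)) = raise_q k (f a)"
        using f \<pi> by (metis bij_imp_bij_inv)
    next
      fix a assume "a \<in> {m'. m' \<subseteq># m \<and> repeat_mset k m' = m}"
      thus "image_mset \<pi> a \<in> {m'. m' \<subseteq># image_mset \<pi> m \<and> repeat_mset k m' = image_mset \<pi> m}"
        by (auto simp: rep image_mset_subseteq_mono)
    qed (simp_all add: inv)
  qed
qed

lift_definition power_sum :: "nat \<Rightarrow> symfun" is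
  "\<lambda>k m. if \<exists>i. m = replicate_mset k i then 1 else 0"
proof (intro conjI)
  fix k
  show "\<exists>d. \<forall>m. (if \<exists>i::nat. m = replicate_mset k i then 1 else (0::ratfun)) \<noteq> 0 \<longrightarrow> size m \<le> d"
    by (rule exI[of _ k]) auto
  show "\<forall>\<pi> m. bij (\<pi> :: nat \<Rightarrow> nat) \<longrightarrow> (if \<exists>i::nat. image_mset \<pi> m = replicate_mset k i then 1 else (0::ratfun)) =
              (if \<exists>i. m = replicate_mset k i then 1 else 0)"
  proof (intro allI impI)
    fix \<pi> :: "nat \<Rightarrow> nat" and m assume \<pi>: "bij \<pi>"
    have inv: "image_mset (inv_into UNIV \<pi>) (image_mset \<pi> a) = a" for a
      using \<pi> by (simp_all add: multiset.map_comp o_def bij_is_inj)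
    have "(\<exists>i. image_mset \<pi> m = replicate_mset k i) \<longleftrightarrow> (\<exists>i. m = replicate_mset k i)"
      by (metis inv image_replicate_mset)
    thus "(if \<exists>i::nat. image_mset \<pi> m = replicate_mset k i then 1 else (0::ratfun)) =
              (if \<exists>i. m = replicate_mset k i then 1 else 0)" by simp
  qed
qed

text \<open>The complete homogeneous symmetric function, zero for a negative index.\<close>

lift_definition complete_sf :: "int \<Rightarrow> symfun" is
  "\<lambda>n m. if int (size m) = n then 1 else 0"
proof (intro conjI)
  fix n
  show "\<exists>d. \<forall>m :: nat multiset. (if int (size m) = n then 1 else (0::ratfun)) \<noteq> 0 \<longrightarrow> size m \<le> d"
    by (rule exI[of _ "nat n"]) auto
qed auto

definition is_partition :: "nat list \<Rightarrow> bool" where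
  "is_partition \<mu> \<longleftrightarrow> sorted_wrt (\<ge>) \<mu> \<and> (\<forall>i \<in> set \<mu>. i > 0)"

text \<open>Schur functions are defined by the Jacobi-Trudi determinant.\<close>

definition schur :: "nat list \<Rightarrow> symfun" where
  "schur \<mu> = det (mat (length \<mu>) (length \<mu>)
     (\<lambda>(i, j). complete_sf (int (\<mu> ! i) - int i + int j)))"


section \<open>Plethystic notation\<close>

text \<open>
  \<open>raise k E\<close> is \<open>p\<^sub>k[E]\<close>: the expression \<open>E\<close> with every variable replaced by its \<open>k\<close>-th power.
\<close>

class plethystic = comm_ring_1 +
  fixes scalar :: "ratfun \<Rightarrow> 'a"
    and raise :: "nat \<Rightarrow> 'a \<Rightarrow> 'a"

instantiation symfun :: plethystic
begin
definition scalar_symfun :: "ratfun \<Rightarrow> symfun" where "scalar = const_sf"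
definition raise_symfun :: "nat \<Rightarrow> symfun \<Rightarrow> symfun" where "raise = raise_sf"
instance ..
end

text \<open>Laurent series: the series variable \<open>z\<close> is raised to its \<open>k\<close>-th power as well.\<close>

instantiation fls :: (plethystic) plethystic
begin
definition scalar_fls :: "ratfun \<Rightarrow> 'a fls" where
  "scalar c = fls_const (scalar c)"
definition raise_fls :: "nat \<Rightarrow> 'a fls \<Rightarrow> 'a fls" where
  "raise k E = Abs_fls (\<lambda>n. if int k dvd n then raise k (fls_nth E (n div int k)) else 0)"
instance ..
end

text \<open>
  A symmetric function is uniquely a linear combination of the products
  \<open>p\<^sub>\<nu> = \<Prod>k\<in>#\<nu>. p\<^sub>k\<close>, where \<open>\<nu>\<close> runs through the finite multisets of positive integers.
\<close>

definition power_sum_expansion :: "symfun \<Rightarrow> nat multiset \<Rightarrow>\<^sub>0 ratfun" where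
  "power_sum_expansion F = (THE c.
     (\<forall>\<nu>\<in>Poly_Mapping.keys c. 0 \<notin># \<nu>) \<and>
     F = (\<Sum>\<nu>\<in>Poly_Mapping.keys c.
            scalar (Poly_Mapping.lookup c \<nu>) * (\<Prod>k\<in>#\<nu>. power_sum k)))"

definition plethysm :: "symfun \<Rightarrow> 'a \<Rightarrow> 'a :: plethystic" where
  "plethysm F E =
     (\<Sum>\<nu>\<in>Poly_Mapping.keys (power_sum_expansion F).
        scalar (Poly_Mapping.lookup (power_sum_expansion F) \<nu>) * (\<Prod>k\<in>#\<nu>. raise k E))"

text \<open>
  The plethystic exponential \<open>exp (\<Sum>k\<ge>1. p\<^sub>k[E] / k)\<close> of a series \<open>E\<close> in positive powers of \<open>z\<close>.
  As \<open>p\<^sub>k[E]\<close> is then divisible by \<open>z ^ k\<close>, only \<open>k \<le> n\<close> contributes to the coefficient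
  of \<open>z ^ n\<close> in the sum.
\<close>

definition plethystic_exp :: "'a :: plethystic fls \<Rightarrow> 'a fls" where
  "plethystic_exp E = fps_to_fls (fps_compose
     (Abs_fps (\<lambda>n. scalar (1 / of_nat (fact n))))
     (Abs_fps (\<lambda>n. \<Sum>k=1..n. scalar (1 / of_nat k) * fls_nth (raise k E) (int n))))"


section \<open>The operators\<close>

definition q_int :: "ratfun \<Rightarrow> int \<Rightarrow> ratfun" where
  "q_int x u = (1 - x powi u) / (1 - x)"

definition M_qt :: ratfun where
  "M_qt = (1 - tvar) * (1 - qvar)"

definition X_sf :: symfun where
  "X_sf = power_sum 1"

definition D_op :: "int \<Rightarrow> int \<Rightarrow> symfun \<Rightarrow> symfun" where
  "D_op u v F =
     fls_nth (plethysm F (fls_const X_sf + scalar (M_qt * q_int qvar u) * fls_X_inv)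
      * plethystic_exp (- (fls_X * scalar (q_int tvar u) * fls_const X_sf))) v"

definition B_stat :: "nat list \<Rightarrow> ratfun \<Rightarrow> ratfun \<Rightarrow> ratfun" where
  "B_stat \<mu> q t = (\<Sum>i<length \<mu>. t ^ i * (\<Sum>j<\<mu> ! i. q ^ j))"

end

(* Put Y = X/(1-q), Q = q^u and w = 1/(qz). Then D_{u,0} sends s_mu[Y] to the z^0 coefficient of
   s_mu[Y + (Q-1)w] * Omega[qz(1-1/Q)Y]. By Jacobi-Trudi, s_mu[Y] = det N with N_ij = h_{c_i+j}[Y] and
   c_i = mu_i - i (i, j counted from 0). Since the generating function of h_k[(Q-1)w] is
   (1-wx)/(1-Qwx), the matrix of s_mu[Y + (Q-1)w] is (N + v s^T) T with T unitriangular, s_j = w^j and v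
   a combination of the columns h_{c-m}[Y], m > 0, so its determinant is det N plus a sum of
   determinants of N with column j replaced by such a column. After taking the z^0 coefficient these
   are exactly the terms in which h(Qx) = Omega[x(Q-1)Y] h(x), applied to column j, leaves the span of
   the columns 0, ..., j; hence they add up to the sum over i of det N with row i scaled by Q^{c_i},
   up to a multiple of det N.

   Plethysm is defined through the expansion in power sums, so the algebraic independence of the power
   sums is needed: the coefficient of a product p_nu at a monomial with r variables vanishes unless
   r <= length nu, and if r = length nu unless the exponents are the parts of nu. *)
theory Submission
  imports Defs
begin

section \<open>Determinants with a replaced column\<close>

definition det_col :: "nat \<Rightarrow> (nat \<Rightarrow> nat \<Rightarrow> 'a) \<Rightarrow> nat \<Rightarrow> (nat \<Rightarrow> 'a) \<Rightarrow> 'a :: comm_ring_1" where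
  "det_col n f k b = det (mat n n (\<lambda>(i, j). if j = k then b i else f i j))"

text \<open>Laplace expansion along column \<open>k\<close>: the minors delete the replaced column,
  so the cofactors do not involve \<open>b\<close>. Linearity in \<open>b\<close> follows from
  this.\<close>

lemma det_col_cofactor:
  assumes "k < n"
  shows "det_col n f k b = (\<Sum>i<n. b i * cofactor (mat n n (\<lambda>(i, j). f i j)) i k)"
proof -
  have "mat_delete (mat n n (\<lambda>(i, j). if j = k then b i else f i j)) i k =
        mat_delete (mat n n (\<lambda>(i, j). f i j)) i k" for i
    by (rule eq_matI) (auto simp: mat_delete_def)
  thus ?thesis
    unfolding det_col_def using assms
    by (subst laplace_expansion_column[of _ n k]) (auto simp: cofactor_def)
qed

lemma det_col_cong: "(\<And>i. i < n \<Longrightarrow> b i = b' i) \<Longrightarrow> det_col n f k b = det_col n f k b'"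
  unfolding det_col_def by (rule arg_cong[of _ _ det], rule eq_matI) auto

lemma det_col_add:
  "k < n \<Longrightarrow> det_col n f k (\<lambda>i. a i + b i) = det_col n f k a + det_col n f k b"
  by (simp add: det_col_cofactor algebra_simps sum.distrib)

lemma det_col_scale: "k < n \<Longrightarrow> det_col n f k (\<lambda>i. c * b i) = c * det_col n f k b"
  by (simp add: det_col_cofactor mult.assoc sum_distrib_left)

lemma det_col_sum:
  assumes "k < n"
  shows "det_col n f k (\<lambda>i. \<Sum>m\<in>S. c m * b m i) = (\<Sum>m\<in>S. c m * det_col n f k (b m))"
  using assms by (simp add: det_col_cofactor sum_distrib_left sum_distrib_right mult.assoc) (rule sum.swap)

lemma det_col_self: "det_col n f k (\<lambda>i. f i k) = det (mat n n (\<lambda>(i, j). f i j))"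
  unfolding det_col_def by (rule arg_cong[of _ _ det], rule eq_matI) auto

lemma det_col_other:
  assumes "k < n" "l < n" "l \<noteq> k"
  shows "det_col n f k (\<lambda>i. f i l) = 0"
  unfolding det_col_def
  by (rule det_identical_columns[of _ n k l]) (use assms in \<open>auto intro!: eq_vecI\<close>)

text \<open>Both sides are the sum of d_i f_ij C_ij over all i and j, with C the cofactors:
  expansion along columns gives the left side, along rows the right side.\<close>

lemma sum_det_col_scaled:
  "(\<Sum>j<n. det_col n f j (\<lambda>i. d i * f i j)) = (\<Sum>i<n. d i) * det (mat n n (\<lambda>(i, j). f i j))"
proof -
  let ?C = "cofactor (mat n n (\<lambda>(i, j). f i j))"
  have "(\<Sum>j<n. det_col n f j (\<lambda>i. d i * f i j)) = (\<Sum>j<n. \<Sum>i<n. d i * f i j * ?C i j)"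
    by (rule sum.cong) (auto simp: det_col_cofactor)
  also have "\<dots> = (\<Sum>i<n. d i * (\<Sum>j<n. f i j * ?C i j))"
    by (subst sum.swap) (simp add: sum_distrib_left mult.assoc)
  also have "\<dots> = (\<Sum>i<n. d i * det (mat n n (\<lambda>(i, j). f i j)))"
  proof (rule sum.cong)
    fix i assume "i \<in> {..<n}"
    thus "d i * (\<Sum>j<n. f i j * ?C i j) = d i * det (mat n n (\<lambda>(i, j). f i j))"
      by (subst laplace_expansion_row[of "mat n n (\<lambda>(i, j). f i j)" n i]) auto
  qed simp
  finally show ?thesis by (simp add: sum_distrib_right)
qed

text \<open>Column \<open>k\<close> is \<open>v\<close> itself, so adding multiples of it to earlier
  columns does not change the determinant.\<close>

lemma det_col_column_op:
  assumes "k < n"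
  shows "det_col n (\<lambda>i j. f i j + (if j < k then v i * s j else 0)) k v = det_col n f k v"
proof -
  define F where "F = mat n n (\<lambda>(i, j). if j = k then v i else f i j)"
  define E where "E = mat n n (\<lambda>(l, j). if l = j then 1 else if l = k \<and> j < k then s j else 0)"
  have FE: "F \<in> carrier_mat n n" "E \<in> carrier_mat n n" by (simp_all add: F_def E_def)
  have "mat n n (\<lambda>(i, j). if j = k then v i else f i j + (if j < k then v i * s j else 0)) = F * E"
  proof (rule eq_matI)
    fix i j assume "i < dim_row (F * E)" "j < dim_col (F * E)"
    hence ij: "i < n" "j < n" using FE by auto
    have "(F * E) $$ (i, j) = (\<Sum>l\<in>{0..<n}. F $$ (i, l) * E $$ (l, j))"
      using ij FE by (simp add: scalar_prod_def)
    also have "\<dots> = (\<Sum>l\<in>{0..<n}. (if l = j then F $$ (i, j) else 0) +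
                       (if l = k then (if j < k then v i * s j else 0) else 0))"
      by (rule sum.cong) (use ij assms in \<open>auto simp: F_def E_def\<close>)
    also have "\<dots> = F $$ (i, j) + (if j < k then v i * s j else 0)"
      using ij assms by (simp add: sum.distrib)
    finally show "mat n n (\<lambda>(i, j). if j = k then v i else f i j + (if j < k then v i * s j else 0)) $$ (i, j)
       = (F * E) $$ (i, j)"
      using ij by (auto simp: F_def)
  qed (use FE in auto)
  moreover have "det E = 1"
    by (subst det_lower_triangular[of n])
       (auto simp: E_def prod_list_diag_prod)
  ultimately show ?thesis
    using det_mult[OF FE] by (simp add: det_col_def F_def)
qed

text \<open>The matrix determinant lemma, with the adjugate spelled out as column replacements. The
  columns are updated one at a time; linearity in the new column splits off one summand, in which
  \<open>det_col_column_op\<close> undoes the earlier updates.\<close>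

lemma det_rank_one_update:
  "det (mat n n (\<lambda>(i, j). f i j + v i * s j)) =
   det (mat n n (\<lambda>(i, j). f i j)) + (\<Sum>j<n. s j * det_col n f j v)"
proof -
  define g where "g k i j = f i j + (if j < k then v i * s j else 0)" for k i j
  have "det (mat n n (\<lambda>(i, j). g k i j)) =
        det (mat n n (\<lambda>(i, j). f i j)) + (\<Sum>j<k. s j * det_col n f j v)" if "k \<le> n" for k
    using that
  proof (induction k)
    case 0
    show ?case by (simp add: g_def)
  next
    case (Suc k)
    hence k: "k < n" by simp
    have "det (mat n n (\<lambda>(i, j). g (Suc k) i j)) = det_col n (g k) k (\<lambda>i. g k i k + s k * v i)"
      unfolding det_col_def
      by (rule arg_cong[of _ _ det], rule eq_matI) (auto simp: g_def less_Suc_eq)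
    also have "\<dots> = det (mat n n (\<lambda>(i, j). g k i j)) + s k * det_col n (g k) k v"
      using k by (simp add: det_col_add det_col_scale det_col_self)
    also have "det_col n (g k) k v = det_col n f k v"
      using det_col_column_op[OF k, of f v s] by (simp add: g_def[abs_def])
    finally show ?case using Suc by simp
  qed
  moreover have "mat n n (\<lambda>(i, j). g n i j) = mat n n (\<lambda>(i, j). f i j + v i * s j)"
    by (rule eq_matI) (auto simp: g_def)
  ultimately show ?thesis by (metis order_refl)
qed

lemma (in comm_ring_hom) det_col_hom:
  "det_col n (\<lambda>i j. hom (f i j)) k (\<lambda>i. hom (b i)) = hom (det_col n f k b)"
  unfolding det_col_def hom_det[symmetric]
  by (rule arg_cong[of _ _ det], rule eq_matI) auto

section \<open>The eigenvalue of a Jacobi-Trudi determinant in an abstract setting\<close>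

lemma sum_atMost_add:
  "(\<Sum>k\<le>j + K. f k) = (\<Sum>k\<le>j. f k) + (\<Sum>m=1..K. f (j + m))" for f :: "nat \<Rightarrow> 'a :: comm_monoid_add"
  by (induction K) (simp_all add: add.assoc)

text \<open>Intended reading: \<phi> embeds constants into Laurent series, \<open>L\<close>
  multiplies by the plethystic exponential and takes the coefficient of z^0, \<open>h n\<close> is
  h_n[Y], \<open>a n\<close> is h_n[Y + (Q-1)w]. The \<open>e k\<close> are the coefficients of
  (1-x)/(1-Qx), and \<open>h_dilate\<close> says h(Qx) = g(Qx) h(x), where g is the generating
  function of \<gamma>.\<close>

lemma det_eigenvector:
  fixes \<phi> :: "'a :: comm_ring_1 \<Rightarrow> 'b :: comm_ring_1" and L :: "'b \<Rightarrow> 'a"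
    and h :: "int \<Rightarrow> 'a" and a :: "int \<Rightarrow> 'b" and \<mu> :: "nat \<Rightarrow> nat"
  assumes hom: "comm_ring_hom \<phi>"
    and L_add: "\<And>x y. L (x + y) = L x + L y"
    and L_scale: "\<And>c x. L (\<phi> c * x) = c * L x"
    and L_power: "\<And>k. L (w ^ k) = \<gamma> k"
    and \<gamma>0: "\<gamma> 0 = 1" and QR: "Q * R = 1"
    and h_neg: "\<And>n. n < 0 \<Longrightarrow> h n = 0"
    and h_dilate: "\<And>n::nat. Q ^ n * h (int n) = (\<Sum>k\<le>n. \<gamma> k * Q ^ k * h (int n - int k))"
    and e_def: "\<And>k. e k = (if k = 0 then 1 else (Q - 1) * Q ^ (k - 1))"
    and a_def: "\<And>n. a n = (\<Sum>k\<le>nat n. \<phi> (e k) * w ^ k * \<phi> (h (n - int k)))"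
  shows "L (det (mat l l (\<lambda>(i, j). a (int (\<mu> i) - int i + int j)))) =
    (1 + (1 - R) * (\<Sum>i<l. R ^ i * (Q ^ \<mu> i - 1))) *
    det (mat l l (\<lambda>(i, j). h (int (\<mu> i) - int i + int j)))"
proof -
  interpret \<phi>: comm_ring_hom \<phi> by (rule hom)
  define c where "c i = int (\<mu> i) - int i" for i
  \<comment> \<open>An upper bound for all \<open>c i\<close>: h_{c_i - m} vanishes for m > K, so
    all tails become finite sums of the same length.\<close>
  define K where "K = (\<Sum>i<l. \<mu> i)"
  have c_le: "c i \<le> int K" if "i < l" for i
  proof -
    have "\<mu> i \<le> K" unfolding K_def using that by (intro member_le_sum) auto
    thus ?thesis by (simp add: c_def)
  qed
  define H where "H i j = h (c i + int j)" for i j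
  define N where "N i j = \<phi> (H i j)" for i j
  \<comment> \<open>Up to the factor Q^j w^j, this is the part of \<open>a (c i + int j)\<close>
    that uses the columns h_{c-m}, m > 0, to the left of the matrix.\<close>
  define v where "v i = (\<Sum>m=1..K. \<phi> (e m) * w ^ m * \<phi> (h (c i - int m)))" for i
  define \<delta> where "\<delta> j m = det_col l H j (\<lambda>i. h (c i - int m))" for j m
  define d where "d = det (mat l l (\<lambda>(i, j). H i j))"
  have RQ_pow: "R ^ k * Q ^ k = 1" "Q ^ k * R ^ k = 1" for k
    using QR by (metis power_mult_distrib power_one mult.commute)+

  \<comment> \<open>Multiplication by \<open>T\<close> convolves the columns with e_k w^k; the
    diagonal entries are \<open>e 0\<close> = 1.\<close>
  define T where "T = mat l l (\<lambda>(t, j). if t \<le> j then \<phi> (e (j - t)) * w ^ (j - t) else 0)"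
  have T: "T \<in> carrier_mat l l" by (simp add: T_def)
  have "det T = 1"
    by (subst det_upper_triangular[of _ l])
       (auto simp: T_def prod_list_diag_prod e_def upper_triangular_def)
  define NV where "NV = mat l l (\<lambda>(i, j). N i j + v i * w ^ j)"
  have NV: "NV \<in> carrier_mat l l" by (simp add: NV_def)

  \<comment> \<open>Dividing (1-x)/(1-Qx) by 1-x leaves 1/(1-Qx). Thus \<open>T\<close> gives the
    rank-one term exactly the weight Q^j that \<open>a_split\<close> requires.\<close>
  have sum_e: "(\<Sum>k\<le>j. e k) = Q ^ j" for j
    by (induction j) (simp_all add: e_def algebra_simps)
  have reverse: "(\<Sum>t\<le>j. f (j - t) t) = (\<Sum>k\<le>j. f k (j - k))" for f :: "nat \<Rightarrow> nat \<Rightarrow> 'b" and j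
    by (rule sum.reindex_bij_witness[of _ "\<lambda>k. j - k" "\<lambda>k. j - k"]) auto
  have a_split: "a (c i + int j) = (\<Sum>k\<le>j. \<phi> (e k) * w ^ k * \<phi> (h (c i + int j - int k))) + \<phi> (Q ^ j) * w ^ j * v i"
    if "i < l" for i j
  proof -
    have "a (c i + int j) = (\<Sum>k\<le>j + K. \<phi> (e k) * w ^ k * \<phi> (h (c i + int j - int k)))"
      unfolding a_def
    proof (rule sum.mono_neutral_left)
      show "{..nat (c i + int j)} \<subseteq> {..j + K}" using c_le[OF that] by auto
      show "\<forall>k\<in>{..j + K} - {..nat (c i + int j)}.
              \<phi> (e k) * w ^ k * \<phi> (h (c i + int j - int k)) = 0"
      proof
        fix k assume "k \<in> {..j + K} - {..nat (c i + int j)}"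
        hence "c i + int j - int k < 0" by auto
        thus "\<phi> (e k) * w ^ k * \<phi> (h (c i + int j - int k)) = 0" by (simp add: h_neg)
      qed
    qed simp
    also have "\<dots> = (\<Sum>k\<le>j. \<phi> (e k) * w ^ k * \<phi> (h (c i + int j - int k))) +
       (\<Sum>m=1..K. \<phi> (e (j + m)) * w ^ (j + m) * \<phi> (h (c i + int j - int (j + m))))"
      by (rule sum_atMost_add)
    also have "(\<Sum>m=1..K. \<phi> (e (j + m)) * w ^ (j + m) * \<phi> (h (c i + int j - int (j + m)))) =
       \<phi> (Q ^ j) * w ^ j * v i"
      unfolding v_def sum_distrib_left
    proof (rule sum.cong)
      fix m assume m: "m \<in> {1..K}"
      \<comment> \<open>The sequence \<open>e\<close> is geometric only from index 1 on, which is
        why the tail \<open>v\<close> starts at m = 1.\<close>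
      hence "e (j + m) = Q ^ j * e m"
        by (cases m) (auto simp: e_def power_add algebra_simps)
      thus "\<phi> (e (j + m)) * w ^ (j + m) * \<phi> (h (c i + int j - int (j + m))) =
         \<phi> (Q ^ j) * w ^ j * (\<phi> (e m) * w ^ m * \<phi> (h (c i - int m)))"
        by (simp add: power_add \<phi>.hom_mult mult_ac)
    qed simp
    finally show ?thesis .
  qed
  have "mat l l (\<lambda>(i, j). a (c i + int j)) = NV * T"
  proof (rule eq_matI)
    fix i j assume "i < dim_row (NV * T)" "j < dim_col (NV * T)"
    hence ij: "i < l" "j < l" using NV T by auto
    have "(NV * T) $$ (i, j) = (\<Sum>t\<in>{0..<l}. NV $$ (i, t) * T $$ (t, j))"
      using ij NV T by (simp add: scalar_prod_def)
    also have "\<dots> = (\<Sum>t\<le>j. (N i t + v i * w ^ t) * (\<phi> (e (j - t)) * w ^ (j - t)))"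
      by (rule sum.mono_neutral_cong_right) (use ij in \<open>auto simp: NV_def T_def\<close>)
    also have "\<dots> = (\<Sum>k\<le>j. (N i (j - k) + v i * w ^ (j - k)) * (\<phi> (e k) * w ^ k))"
      by (rule reverse)
    also have "\<dots> = (\<Sum>k\<le>j. \<phi> (e k) * w ^ k * \<phi> (h (c i + int j - int k)) + v i * w ^ j * \<phi> (e k))"
    proof (rule sum.cong)
      fix k assume "k \<in> {..j}"
      hence "w ^ j = w ^ (j - k) * w ^ k" by (simp flip: power_add)
      thus "(N i (j - k) + v i * w ^ (j - k)) * (\<phi> (e k) * w ^ k) =
         \<phi> (e k) * w ^ k * \<phi> (h (c i + int j - int k)) + v i * w ^ j * \<phi> (e k)"
        using \<open>k \<in> {..j}\<close> by (simp add: N_def H_def algebra_simps of_nat_diff)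
    qed simp
    also have "\<dots> = (\<Sum>k\<le>j. \<phi> (e k) * w ^ k * \<phi> (h (c i + int j - int k))) + \<phi> (Q ^ j) * w ^ j * v i"
      by (simp add: sum.distrib flip: sum_distrib_left \<phi>.hom_sum sum_e)
    also have "\<dots> = a (c i + int j)"
      using ij by (simp add: a_split)
    finally show "mat l l (\<lambda>(i, j). a (c i + int j)) $$ (i, j) = (NV * T) $$ (i, j)"
      using ij by simp
  qed (use NV T in auto)
  hence "det (mat l l (\<lambda>(i, j). a (c i + int j))) = det NV"
    using det_mult[OF NV T] \<open>det T = 1\<close> by simp
  also have "\<dots> = det (mat l l (\<lambda>(i, j). N i j)) + (\<Sum>j<l. w ^ j * det_col l N j v)"
    unfolding NV_def by (rule det_rank_one_update)
  also have "det (mat l l (\<lambda>(i, j). N i j)) = \<phi> d"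
    unfolding d_def \<phi>.hom_det[symmetric]
    by (rule arg_cong[of _ _ det], rule eq_matI) (auto simp: N_def)
  also have "(\<Sum>j<l. w ^ j * det_col l N j v) = (\<Sum>j<l. \<Sum>m=1..K. \<phi> (e m * \<delta> j m) * w ^ (j + m))"
  proof (rule sum.cong)
    fix j assume "j \<in> {..<l}"
    hence j: "j < l" by simp
    have "det_col l N j v = (\<Sum>m=1..K. \<phi> (e m) * w ^ m * \<phi> (\<delta> j m))"
      unfolding v_def \<delta>_def N_def using j by (simp add: det_col_sum \<phi>.det_col_hom)
    thus "w ^ j * det_col l N j v = (\<Sum>m=1..K. \<phi> (e m * \<delta> j m) * w ^ (j + m))"
      by (simp add: sum_distrib_left power_add \<phi>.hom_mult mult_ac)
  qed simp
  finally have det_a: "det (mat l l (\<lambda>(i, j). a (c i + int j))) =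
    \<phi> d + (\<Sum>j<l. \<Sum>m=1..K. \<phi> (e m * \<delta> j m) * w ^ (j + m))" .

  have L0: "L 0 = 0" using L_add[of 0 0] by simp
  have L_sum: "L (sum f S) = (\<Sum>x\<in>S. L (f x))" for f :: "nat \<Rightarrow> 'b" and S
    by (induction S rule: infinite_finite_induct) (auto simp: L0 L_add)
  have "L (\<phi> d) = d" using L_scale[of d 1] L_power[of 0] \<gamma>0 by simp
  hence L_det: "L (det (mat l l (\<lambda>(i, j). a (c i + int j)))) =
    d + (\<Sum>j<l. \<Sum>m=1..K. e m * \<delta> j m * \<gamma> (j + m))"
    by (simp add: det_a L_add L_sum L_scale L_power)

  \<comment> \<open>Scale column j of \<open>H\<close> row by row with Q^{c_i} and expand it by
    \<open>h_dilate\<close>: k = 0 gives \<open>d\<close>, the terms 1 \<le> k \<le> j repeat a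
    column and vanish, and k = j + m gives the determinants \<delta> left by the rank-one update.
    The scaling is written with both \<open>Q\<close> and \<open>R\<close> because c_i may be
    negative.\<close>
  have column: "(\<Sum>m=1..K. e m * \<delta> j m * \<gamma> (j + m)) =
      (1 - R) * (det_col l H j (\<lambda>i. Q ^ \<mu> i * R ^ i * H i j) - R ^ j * d)" if j: "j < l" for j
  proof -
    have row: "Q ^ j * (Q ^ \<mu> i * R ^ i * H i j) =
        (\<Sum>k\<le>j. \<gamma> k * Q ^ k * H i (j - k)) + (\<Sum>m=1..K. \<gamma> (j + m) * Q ^ (j + m) * h (c i - int m))"
      if i: "i < l" for i
    proof -
      have "Q ^ j * (Q ^ \<mu> i * R ^ i * H i j) = (\<Sum>k\<le>j + K. \<gamma> k * Q ^ k * h (c i + int j - int k))"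
      proof (cases "c i + int j < 0")
        case True
        thus ?thesis by (simp add: H_def h_neg)
      next
        case False
        define n where "n = nat (c i + int j)"
        have n: "c i + int j = int n" using False by (simp add: n_def)
        hence "\<mu> i + j = n + i" by (simp add: c_def)
        \<comment> \<open>The identity Q^{c_i} Q^j = Q^n, freed of negative exponents.\<close>
        hence QQ: "Q ^ \<mu> i * Q ^ j = Q ^ n * Q ^ i" by (simp flip: power_add)
        have "Q ^ j * (Q ^ \<mu> i * R ^ i * H i j) = (Q ^ \<mu> i * Q ^ j) * (R ^ i * H i j)"
          by (simp add: mult_ac)
        also have "\<dots> = Q ^ n * H i j * (Q ^ i * R ^ i)"
          unfolding QQ by (simp add: mult_ac)
        also have "\<dots> = (\<Sum>k\<le>n. \<gamma> k * Q ^ k * h (int n - int k))"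
          by (simp add: RQ_pow H_def n h_dilate)
        also have "\<dots> = (\<Sum>k\<le>j + K. \<gamma> k * Q ^ k * h (int n - int k))"
        proof (rule sum.mono_neutral_left)
          show "{..n} \<subseteq> {..j + K}" using c_le[OF i] n by auto
        qed (auto simp: h_neg)
        finally show ?thesis by (simp add: n)
      qed
      also have "\<dots> = (\<Sum>k\<le>j. \<gamma> k * Q ^ k * h (c i + int j - int k)) +
          (\<Sum>m=1..K. \<gamma> (j + m) * Q ^ (j + m) * h (c i + int j - int (j + m)))"
        by (rule sum_atMost_add)
      finally show ?thesis by (simp add: H_def of_nat_diff algebra_simps)
    qed
    let ?D = "det_col l H j"
    have "Q ^ j * ?D (\<lambda>i. Q ^ \<mu> i * R ^ i * H i j) =
       ?D (\<lambda>i. (\<Sum>k\<le>j. \<gamma> k * Q ^ k * H i (j - k)) +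
               (\<Sum>m=1..K. \<gamma> (j + m) * Q ^ (j + m) * h (c i - int m)))"
      unfolding det_col_scale[OF j, symmetric] by (rule det_col_cong) (rule row)
    also have "\<dots> = (\<Sum>k\<le>j. \<gamma> k * Q ^ k * ?D (\<lambda>i. H i (j - k))) +
       (\<Sum>m=1..K. \<gamma> (j + m) * Q ^ (j + m) * \<delta> j m)"
      by (simp add: det_col_add[OF j] det_col_sum[OF j] \<delta>_def)
    also have "(\<Sum>k\<le>j. \<gamma> k * Q ^ k * ?D (\<lambda>i. H i (j - k))) = (\<Sum>k\<in>{0}. \<gamma> k * Q ^ k * ?D (\<lambda>i. H i (j - k)))"
    proof (rule sum.mono_neutral_right)
      show "\<forall>k\<in>{..j} - {0}. \<gamma> k * Q ^ k * ?D (\<lambda>i. H i (j - k)) = 0"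
      proof
        fix k assume "k \<in> {..j} - {0}"
        hence "?D (\<lambda>i. H i (j - k)) = 0" using j by (intro det_col_other) auto
        thus "\<gamma> k * Q ^ k * ?D (\<lambda>i. H i (j - k)) = 0" by simp
      qed
    qed auto
    also have "\<dots> = d" by (simp add: \<gamma>0 det_col_self d_def)
    finally have "R ^ j * (Q ^ j * ?D (\<lambda>i. Q ^ \<mu> i * R ^ i * H i j)) =
       R ^ j * d + R ^ j * (\<Sum>m=1..K. \<gamma> (j + m) * Q ^ (j + m) * \<delta> j m)"
      by (simp add: distrib_left)
    hence "?D (\<lambda>i. Q ^ \<mu> i * R ^ i * H i j) - R ^ j * d =
       R ^ j * (\<Sum>m=1..K. \<gamma> (j + m) * Q ^ (j + m) * \<delta> j m)"
      by (simp add: RQ_pow flip: mult.assoc)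
    also have "(1 - R) * \<dots> = (\<Sum>m=1..K. e m * \<delta> j m * \<gamma> (j + m))"
      unfolding sum_distrib_left
    proof (rule sum.cong)
      fix m assume "m \<in> {1..K}"
      hence "e m = (Q - 1) * Q ^ (m - 1)" "Q ^ m = Q * Q ^ (m - 1)"
        by (auto simp: e_def simp flip: power_Suc)
      \<comment> \<open>As QR = 1, the factor 1 - R turns Q into Q - 1, and hence Q^m into
        \<open>e m\<close> for every m \<ge> 1.\<close>
      moreover have "(1 - R) * (Q * Q ^ (m - 1)) = (Q - Q * R) * Q ^ (m - 1)"
        by (simp add: algebra_simps)
      ultimately have e: "e m = (1 - R) * Q ^ m" by (simp add: QR)
      have "(1 - R) * (R ^ j * (\<gamma> (j + m) * Q ^ (j + m) * \<delta> j m)) =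
        (R ^ j * Q ^ j) * (e m * \<delta> j m * \<gamma> (j + m))"
        by (simp add: power_add e mult_ac)
      thus "(1 - R) * (R ^ j * (\<gamma> (j + m) * Q ^ (j + m) * \<delta> j m)) = e m * \<delta> j m * \<gamma> (j + m)"
        by (simp add: RQ_pow)
    qed simp
    finally show ?thesis by simp
  qed
  have "(\<Sum>j<l. \<Sum>m=1..K. e m * \<delta> j m * \<gamma> (j + m)) =
    (\<Sum>j<l. (1 - R) * (det_col l H j (\<lambda>i. Q ^ \<mu> i * R ^ i * H i j) - R ^ j * d))"
    by (rule sum.cong) (auto intro: column[simplified])
  also have "\<dots> =
    (1 - R) * ((\<Sum>j<l. det_col l H j (\<lambda>i. Q ^ \<mu> i * R ^ i * H i j)) - (\<Sum>j<l. R ^ j) * d)"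
    by (simp add: sum_subtractf sum_distrib_right flip: sum_distrib_left)
  \<comment> \<open>Summed over all columns, the scaled determinants collapse to \<open>d\<close>
    times the sum of Q^{c_i} over the rows.\<close>
  also have "\<dots> = (1 - R) * ((\<Sum>i<l. Q ^ \<mu> i * R ^ i) * d - (\<Sum>j<l. R ^ j) * d)"
    by (simp only: sum_det_col_scaled d_def)
  also have "\<dots> = (1 - R) * (\<Sum>i<l. R ^ i * (Q ^ \<mu> i - 1)) * d"
    by (simp add: algebra_simps sum_subtractf sum_distrib_left)
  finally show ?thesis
    using L_det by (simp add: c_def[symmetric] d_def H_def[symmetric] distrib_right)
qed

section \<open>Newton's recursion\<close>

text \<open>Characterises \<open>A\<close> as \<open>exp (\<Sum>k\<ge>1. p k * x ^ k / k)\<close> without division.\<close>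

definition is_omega :: "(nat \<Rightarrow> 'a) \<Rightarrow> 'a :: comm_ring_1 fps \<Rightarrow> bool" where
  "is_omega p A \<longleftrightarrow> fps_nth A 0 = 1 \<and>
     (\<forall>n. of_nat n * fps_nth A n = (\<Sum>k=1..n. p k * fps_nth A (n - k)))"

text \<open>The logarithmic derivative in the form x A' = (sum of p_k x^k) A. The sum starts at k =
  1, hence the separate case n = 0.\<close>

lemma is_omega_fps_deriv:
  "is_omega p A \<longleftrightarrow> fps_nth A 0 = 1 \<and>
     fps_X * fps_deriv A = Abs_fps (\<lambda>n. if n = 0 then 0 else p n) * A"
proof -
  have "fps_nth (fps_X * fps_deriv A) n = of_nat n * fps_nth A n" for n
    by (cases n) auto
  moreover have "fps_nth (Abs_fps (\<lambda>n. if n = 0 then 0 else p n) * A) n =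
      (\<Sum>k=1..n. p k * fps_nth A (n - k))" for n
    unfolding fps_mult_nth by (rule sum.mono_neutral_cong_right) auto
  ultimately show ?thesis by (simp add: is_omega_def fps_eq_iff)
qed

lemma is_omega_cong:
  "is_omega p A \<Longrightarrow> (\<And>k. k > 0 \<Longrightarrow> p k = p' k) \<Longrightarrow> is_omega p' A"
  unfolding is_omega_def by auto

text \<open>Omega[E + F] = Omega[E] Omega[F], from the Leibniz rule.\<close>

lemma is_omega_mult:
  assumes "is_omega p A" "is_omega p' B"
  shows "is_omega (\<lambda>k. p k + p' k) (A * B)"
proof -
  let ?F = "\<lambda>p. Abs_fps (\<lambda>n. if n = 0 then 0 else p n)"
  have "?F (\<lambda>k. p k + p' k) = ?F p + ?F p'" by (simp add: fps_eq_iff)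
  moreover have "fps_X * fps_deriv (A * B) = (fps_X * fps_deriv A) * B + A * (fps_X * fps_deriv B)"
    by (simp add: algebra_simps)
  ultimately show ?thesis using assms
    unfolding is_omega_fps_deriv by (simp add: algebra_simps)
qed

text \<open>Once n can be cancelled, the recursion determines each coefficient from the earlier
  ones. Identities between generating functions thus reduce to identities between the values
  p_k.\<close>

lemma is_omega_unique:
  fixes A B :: "'a :: comm_ring_1 fps"
  assumes "is_omega p A" "is_omega p B"
    and inv: "\<And>n. n > 0 \<Longrightarrow> \<exists>r :: 'a. r * of_nat n = 1"
  shows "A = B"
proof -
  have "fps_nth A n = fps_nth B n" for n
  proof (induction n rule: less_induct)
    case (less n)
    show ?case
    proof (cases "n = 0")
      case False
      then obtain r :: 'a where r: "r * of_nat n = 1" using inv by blast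
      have "of_nat n * fps_nth A n = of_nat n * fps_nth B n"
        using assms(1,2) less.IH by (auto simp: is_omega_def intro!: sum.cong)
      hence "r * of_nat n * fps_nth A n = r * of_nat n * fps_nth B n"
        by (simp add: mult.assoc)
      thus ?thesis by (simp add: r)
    qed (use assms in \<open>simp add: is_omega_def\<close>)
  qed
  thus ?thesis by (simp add: fps_eq_iff)
qed

lemma is_omega_dilate:
  assumes "is_omega p A"
  shows "is_omega (\<lambda>k. c ^ k * p k) (Abs_fps (\<lambda>n. c ^ n * fps_nth A n))"
proof -
  have "of_nat n * (c ^ n * fps_nth A n) = (\<Sum>k=1..n. c ^ k * p k * (c ^ (n - k) * fps_nth A (n - k)))" for n
  proof -
    have A: "of_nat n * fps_nth A n = (\<Sum>k=1..n. p k * fps_nth A (n - k))"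
      using assms unfolding is_omega_def by blast
    have "of_nat n * (c ^ n * fps_nth A n) = c ^ n * (\<Sum>k=1..n. p k * fps_nth A (n - k))"
      unfolding A[symmetric] by (simp only: mult_ac)
    also have "\<dots> = (\<Sum>k=1..n. c ^ k * p k * (c ^ (n - k) * fps_nth A (n - k)))"
      unfolding sum_distrib_left
    proof (rule sum.cong)
      fix k assume "k \<in> {1..n}"
      hence "c ^ n = c ^ k * c ^ (n - k)" by (simp flip: power_add)
      thus "c ^ n * (p k * fps_nth A (n - k)) = c ^ k * p k * (c ^ (n - k) * fps_nth A (n - k))"
        by (simp add: mult_ac)
    qed simp
    finally show ?thesis .
  qed
  thus ?thesis using assms by (simp add: is_omega_def)
qed

lemma is_omega_hom:
  assumes "comm_ring_hom f" "is_omega p A"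
  shows "is_omega (\<lambda>k. f (p k)) (Abs_fps (\<lambda>n. f (fps_nth A n)))"
proof -
  interpret comm_ring_hom f by (rule assms)
  have "f (of_nat n * fps_nth A n) = f (\<Sum>k=1..n. p k * fps_nth A (n - k))" for n
    using assms(2) by (simp add: is_omega_def)
  thus ?thesis using assms(2) by (simp add: is_omega_def hom_distribs)
qed

text \<open>The series is (1-wx)/(1-Qwx), whose logarithm is the sum of (Q^k - 1) w^k x^k / k. The
  recursion is first checked without \<open>w\<close>, which homogeneity then restores.\<close>

lemma is_omega_geometric:
  fixes Q w :: "'a :: comm_ring_1"
  assumes e_def: "\<And>k. e k = (if k = 0 then 1 else (Q - 1) * Q ^ (k - 1))"
  shows "is_omega (\<lambda>k. (Q ^ k - 1) * w ^ k) (Abs_fps (\<lambda>k. e k * w ^ k))"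
proof -
  have e: "of_nat (Suc n) * e (Suc n) = (\<Sum>k=1..Suc n. (Q ^ k - 1) * e (Suc n - k))" for n
  proof (induction n)
    case 0
    show ?case by (simp add: e_def)
  next
    case (Suc n)
    let ?T = "\<Sum>k=1..n. (Q ^ k - 1) * e (Suc n - k)"
    \<comment> \<open>For k \<le> n both indices of \<open>e\<close> are positive, so raising the
      index by one multiplies by Q; the terms k = n + 1 and k = n + 2 are treated apart.\<close>
    have "(\<Sum>k=1..n. (Q ^ k - 1) * e (Suc (Suc n) - k)) = Q * ?T"
      unfolding sum_distrib_left
      by (rule sum.cong) (auto simp: e_def Suc_diff_le mult_ac)
    hence "(\<Sum>k=1..Suc (Suc n). (Q ^ k - 1) * e (Suc (Suc n) - k)) =
       Q * (?T + (Q ^ Suc n - 1)) - Q * (Q ^ Suc n - 1) + (Q ^ Suc n - 1) * (Q - 1) + (Q ^ Suc (Suc n) - 1)"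
      by (simp add: e_def algebra_simps)
    also have "?T + (Q ^ Suc n - 1) = of_nat (Suc n) * e (Suc n)"
      using Suc by (simp add: e_def)
    finally show ?case by (simp add: e_def algebra_simps)
  qed
  have "of_nat n * (e n * w ^ n) = (\<Sum>k=1..n. (Q ^ k - 1) * w ^ k * (e (n - k) * w ^ (n - k)))" for n
  proof (cases n)
    case (Suc m)
    have "of_nat n * (e n * w ^ n) = (\<Sum>k=1..n. (Q ^ k - 1) * e (n - k)) * w ^ n"
      unfolding Suc e[symmetric] by (simp only: mult.assoc)
    also have "\<dots> = (\<Sum>k=1..n. (Q ^ k - 1) * w ^ k * (e (n - k) * w ^ (n - k)))"
      unfolding sum_distrib_right
    proof (rule sum.cong)
      fix k assume "k \<in> {1..n}"
      hence "w ^ n = w ^ k * w ^ (n - k)" by (simp flip: power_add)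
      thus "(Q ^ k - 1) * e (n - k) * w ^ n = (Q ^ k - 1) * w ^ k * (e (n - k) * w ^ (n - k))"
        by (simp add: mult_ac)
    qed simp
    finally show ?thesis .
  qed simp
  thus ?thesis by (simp add: is_omega_def e_def)
qed

text \<open>The chain rule: the derivative of exp(b) is b' exp(b). The conditions on
  \<open>E\<close> characterise 1/n! without division in the ring.\<close>

lemma is_omega_compose_exp:
  assumes b0: "fps_nth b 0 = 0"
    and E0: "E 0 = 1" and E_Suc: "\<And>n. of_nat (Suc n) * E (Suc n) = E n"
  shows "is_omega (\<lambda>n. of_nat n * fps_nth b n) (fps_compose (Abs_fps E) b)"
proof -
  have low: "fps_nth (b ^ i) n = 0" if "n < i" for i n
    using b0 that by (simp add: startsby_zero_power_prefix)
  have pow: "of_nat n * fps_nth (b ^ i) n =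
     of_nat i * (\<Sum>k=1..n. of_nat k * fps_nth b k * fps_nth (b ^ (i - 1)) (n - k))" for i n
  proof -
    have "of_nat n * fps_nth (b ^ i) n = fps_nth (fps_X * fps_deriv (b ^ i)) n"
      by (cases n) auto
    also have "fps_X * fps_deriv (b ^ i) = of_nat i * ((fps_X * fps_deriv b) * b ^ (i - 1))"
      by (simp add: fps_deriv_power' mult_ac)
    also have "fps_nth \<dots> n = of_nat i * fps_nth ((fps_X * fps_deriv b) * b ^ (i - 1)) n"
      by (simp add: fps_of_nat[symmetric])
    also have "fps_nth ((fps_X * fps_deriv b) * b ^ (i - 1)) n =
       (\<Sum>k=0..n. of_nat k * fps_nth b k * fps_nth (b ^ (i - 1)) (n - k))"
      unfolding fps_mult_nth[of "fps_X * fps_deriv b"] by (rule sum.cong) (auto split: nat.splits)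
    also have "\<dots> = (\<Sum>k=1..n. of_nat k * fps_nth b k * fps_nth (b ^ (i - 1)) (n - k))"
      by (rule sum.mono_neutral_right) (auto simp: Suc_le_eq)
    finally show ?thesis .
  qed
  have E_pred: "E i * of_nat i = E (i - 1)" if "Suc 0 \<le> i" for i
    using E_Suc[of "i - 1"] that by (simp add: mult.commute)
  have "of_nat n * (\<Sum>i=0..n. E i * fps_nth (b ^ i) n) =
     (\<Sum>k=1..n. of_nat k * fps_nth b k * (\<Sum>i=0..n-k. E i * fps_nth (b ^ i) (n - k)))" for n
  proof -
    have "of_nat n * (\<Sum>i=0..n. E i * fps_nth (b ^ i) n) =
       (\<Sum>i=0..n. E i * of_nat i * (\<Sum>k=1..n. of_nat k * fps_nth b k * fps_nth (b ^ (i - 1)) (n - k)))"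
      unfolding sum_distrib_left[of "of_nat n"]
      by (rule sum.cong) (auto simp: pow mult.assoc mult.left_commute[of "of_nat n"])
    also have "\<dots> = (\<Sum>i=1..n. E i * of_nat i * (\<Sum>k=1..n. of_nat k * fps_nth b k * fps_nth (b ^ (i - 1)) (n - k)))"
      by (rule sum.mono_neutral_right) (auto simp: Suc_le_eq)
    \<comment> \<open>The exponential series is its own derivative: i E_i becomes E_{i-1}, and the
      index is shifted.\<close>
    also have "\<dots> = (\<Sum>i<n. E i * (\<Sum>k=1..n. of_nat k * fps_nth b k * fps_nth (b ^ i) (n - k)))"
      by (rule sum.reindex_bij_witness[of _ Suc "\<lambda>i. i - 1"])
         (auto simp: E_pred)
    also have "\<dots> = (\<Sum>k=1..n. of_nat k * fps_nth b k * (\<Sum>i<n. E i * fps_nth (b ^ i) (n - k)))"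
      unfolding sum_distrib_left by (subst sum.swap) (simp add: mult_ac)
    \<comment> \<open>As \<open>b\<close> has no constant term, powers beyond n - k do not reach
      degree n - k.\<close>
    also have "\<dots> = (\<Sum>k=1..n. of_nat k * fps_nth b k * (\<Sum>i=0..n-k. E i * fps_nth (b ^ i) (n - k)))"
    proof (rule sum.cong)
      fix k assume "k \<in> {1..n}"
      hence "(\<Sum>i<n. E i * fps_nth (b ^ i) (n - k)) = (\<Sum>i=0..n-k. E i * fps_nth (b ^ i) (n - k))"
        by (intro sum.mono_neutral_right) (auto simp: low)
      thus "of_nat k * fps_nth b k * (\<Sum>i<n. E i * fps_nth (b ^ i) (n - k)) =
            of_nat k * fps_nth b k * (\<Sum>i=0..n-k. E i * fps_nth (b ^ i) (n - k))" by simp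
    qed simp
    finally show ?thesis .
  qed
  thus ?thesis by (simp add: is_omega_def fps_compose_nth E0)
qed

section \<open>Polynomials in the power sums\<close>

text \<open>The monomial \<open>\<nu>\<close> stands for the product of the variables \<open>p\<^sub>k\<close>, \<open>k \<in># \<nu>\<close>.\<close>

type_synonym ppoly = "nat multiset \<Rightarrow>\<^sub>0 ratfun"

definition eval_ppoly :: "(ratfun \<Rightarrow> 'a) \<Rightarrow> (nat \<Rightarrow> 'a) \<Rightarrow> ppoly \<Rightarrow> 'a :: comm_ring_1" where
  "eval_ppoly \<sigma> x c = (\<Sum>\<nu>\<in>Poly_Mapping.keys c. \<sigma> (Poly_Mapping.lookup c \<nu>) * (\<Prod>k\<in>#\<nu>. x k))"

lemma ppoly_eq_sum_single: "c = (\<Sum>\<nu>\<in>Poly_Mapping.keys c. Poly_Mapping.single \<nu> (Poly_Mapping.lookup c \<nu>))"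
  by (rule poly_mapping_eqI) (auto simp: lookup_sum lookup_single when_def in_keys_iff)

lemma comm_ring_hom_eval_ppoly:
  assumes "comm_ring_hom \<sigma>"
  shows "comm_ring_hom (eval_ppoly \<sigma> x)"
proof -
  interpret \<sigma>: comm_ring_hom \<sigma> by (rule assms)
  have add: "eval_ppoly \<sigma> x (c + d) = eval_ppoly \<sigma> x c + eval_ppoly \<sigma> x d" for c d
    unfolding eval_ppoly_def by (rule setsum_keys_plus_distrib) (auto simp: \<sigma>.hom_add algebra_simps)
  have zero: "eval_ppoly \<sigma> x 0 = 0" by (simp add: eval_ppoly_def)
  have sum: "eval_ppoly \<sigma> x (sum f S) = (\<Sum>s\<in>S. eval_ppoly \<sigma> x (f s))" for f :: "nat multiset \<Rightarrow> ppoly" and S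
    by (induction S rule: infinite_finite_induct) (auto simp: add zero)
  have single: "eval_ppoly \<sigma> x (Poly_Mapping.single \<nu> a) = \<sigma> a * (\<Prod>k\<in>#\<nu>. x k)" for \<nu> a
    by (simp add: eval_ppoly_def)
  have mult: "eval_ppoly \<sigma> x (c * d) = eval_ppoly \<sigma> x c * eval_ppoly \<sigma> x d" for c d
  proof -
    let ?s = "\<lambda>c \<nu>. Poly_Mapping.single \<nu> (Poly_Mapping.lookup c \<nu>) :: ppoly"
    have "eval_ppoly \<sigma> x (c * d) =
          eval_ppoly \<sigma> x ((\<Sum>\<nu>\<in>Poly_Mapping.keys c. ?s c \<nu>) * (\<Sum>\<kappa>\<in>Poly_Mapping.keys d. ?s d \<kappa>))"
      by (simp flip: ppoly_eq_sum_single)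
    also have "\<dots> = (\<Sum>\<nu>\<in>Poly_Mapping.keys c. \<Sum>\<kappa>\<in>Poly_Mapping.keys d. eval_ppoly \<sigma> x (?s c \<nu>) * eval_ppoly \<sigma> x (?s d \<kappa>))"
      by (simp add: sum_product sum single mult_single \<sigma>.hom_mult mult_ac)
    also have "\<dots> = eval_ppoly \<sigma> x (\<Sum>\<nu>\<in>Poly_Mapping.keys c. ?s c \<nu>) * eval_ppoly \<sigma> x (\<Sum>\<kappa>\<in>Poly_Mapping.keys d. ?s d \<kappa>)"
      by (simp add: sum_product sum)
    finally show ?thesis by (simp flip: ppoly_eq_sum_single)
  qed
  have one: "eval_ppoly \<sigma> x 1 = 1" by (simp add: eval_ppoly_def)
  show ?thesis
    by standard (auto simp: add zero mult one)
qed

lemma comm_ring_hom_single0: "comm_ring_hom (Poly_Mapping.single 0 :: ratfun \<Rightarrow> ppoly)"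
  by standard (auto simp: single_add mult_single)

definition pvar :: "nat \<Rightarrow> ppoly" where
  "pvar k = Poly_Mapping.single {#k#} 1"

lemma eval_ppoly_pvar:
  assumes "comm_ring_hom \<sigma>"
  shows "eval_ppoly \<sigma> x (pvar k) = x k"
proof -
  interpret comm_ring_hom \<sigma> by (rule assms)
  show ?thesis by (simp add: eval_ppoly_def pvar_def)
qed

text \<open>The complete homogeneous function h_n as a polynomial in indeterminates p_k, from n h_n
  = sum of p_k h_{n-k} solved for h_n.\<close>

fun hpoly :: "nat \<Rightarrow> ppoly" where
  "hpoly 0 = 1"
| "hpoly (Suc n) = Poly_Mapping.single 0 (1 / of_nat (Suc n)) * (\<Sum>k\<le>n. pvar (Suc k) * hpoly (n - k))"

lemma is_omega_hpoly: "is_omega pvar (Abs_fps hpoly)"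
proof -
  interpret s: comm_ring_hom "Poly_Mapping.single 0 :: ratfun \<Rightarrow> ppoly" by (rule comm_ring_hom_single0)
  have "of_nat n * hpoly n = (\<Sum>k=1..n. pvar k * hpoly (n - k))" for n
  proof (cases n)
    case (Suc m)
    have "of_nat (Suc m) * Poly_Mapping.single 0 (1 / of_nat (Suc m)) = (1 :: ppoly)"
      unfolding s.hom_of_nat[symmetric] s.hom_mult[symmetric]
      by (simp del: of_nat_Suc)
    moreover have "(\<Sum>k=1..n. pvar k * hpoly (n - k)) = (\<Sum>k\<le>m. pvar (Suc k) * hpoly (m - k))"
      by (rule sum.reindex_bij_witness[of _ Suc "\<lambda>k. k - 1"]) (auto simp: Suc)
    ultimately show ?thesis by (simp add: Suc del: of_nat_Suc flip: mult.assoc)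
  qed simp
  thus ?thesis by (simp add: is_omega_def)
qed

text \<open>\<open>power_sum 0\<close> is a constant, so expansions in power sums are unique only without \<open>p\<^sub>0\<close>.\<close>

definition pos_vars :: "ppoly set" where
  "pos_vars = {c. \<forall>\<nu>\<in>Poly_Mapping.keys c. 0 \<notin># \<nu>}"

lemma pos_vars_add: "c \<in> pos_vars \<Longrightarrow> d \<in> pos_vars \<Longrightarrow> c + d \<in> pos_vars"
  unfolding pos_vars_def using keys_add[of c d] by blast

lemma pos_vars_uminus: "c \<in> pos_vars \<Longrightarrow> - c \<in> pos_vars"
  by (simp add: pos_vars_def)

lemma pos_vars_mult: "c \<in> pos_vars \<Longrightarrow> d \<in> pos_vars \<Longrightarrow> c * d \<in> pos_vars"
  unfolding pos_vars_def using keys_mult[of c d] by fastforce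

lemma pos_vars_0: "0 \<in> pos_vars" and pos_vars_1: "1 \<in> pos_vars"
  by (simp_all add: pos_vars_def)

lemma pos_vars_single: "0 \<notin># \<nu> \<Longrightarrow> Poly_Mapping.single \<nu> a \<in> pos_vars"
  by (simp add: pos_vars_def)

lemma pos_vars_sum: "(\<And>s. s \<in> S \<Longrightarrow> f s \<in> pos_vars) \<Longrightarrow> sum f S \<in> pos_vars"
  by (induction S rule: infinite_finite_induct) (auto simp: pos_vars_0 pos_vars_add)

lemma pos_vars_prod: "(\<And>s. s \<in> S \<Longrightarrow> f s \<in> pos_vars) \<Longrightarrow> prod f S \<in> pos_vars"
  by (induction S rule: infinite_finite_induct) (auto simp: pos_vars_1 pos_vars_mult)

lemma pos_vars_det:
  assumes "\<And>i j. i < n \<Longrightarrow> j < n \<Longrightarrow> f i j \<in> pos_vars"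
  shows "det (mat n n (\<lambda>(i, j). f i j)) \<in> pos_vars"
proof -
  have "(signof p :: ppoly) \<in> pos_vars" for p :: "nat \<Rightarrow> nat"
    by (simp add: sign_def pos_vars_1 pos_vars_uminus)
  thus ?thesis
    by (subst det_def'[of _ n])
       (auto intro!: pos_vars_sum pos_vars_mult pos_vars_prod assms simp: permutes_in_image)
qed

lemma pos_vars_pvar: "k > 0 \<Longrightarrow> pvar k \<in> pos_vars"
  by (simp add: pvar_def pos_vars_single)

lemma pos_vars_hpoly: "hpoly n \<in> pos_vars"
  by (induction n rule: hpoly.induct)
     (auto simp: pos_vars_1 intro!: pos_vars_mult pos_vars_sum pos_vars_single pos_vars_pvar)

section \<open>Coefficients of symmetric functions and Newton's identity for h_n\<close>

lemma coeff_sum_sf: "coeff_sf (sum f S) m = (\<Sum>s\<in>S. coeff_sf (f s) m)"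
  by (induction S rule: infinite_finite_induct) (simp_all add: zero_symfun.rep_eq plus_symfun.rep_eq)

lemma coeff_const_mult: "coeff_sf (const_sf c * F) m = c * coeff_sf F m"
proof -
  have "coeff_sf (const_sf c * F) m = (\<Sum>(a, b)\<in>{({#}, m)}. coeff_sf (const_sf c) a * coeff_sf F b)"
    unfolding times_symfun.rep_eq
    by (intro sum.mono_neutral_right finite_mset_splits) (auto split: if_splits)
  thus ?thesis by simp
qed

lemma symfun_eqI: "(\<And>m. coeff_sf F m = coeff_sf G m) \<Longrightarrow> F = G"
  using coeff_sf_inject by blast

lemma comm_ring_hom_const_sf: "comm_ring_hom const_sf"
  by standard
     (auto intro!: symfun_eqI simp: coeff_const_mult plus_symfun.rep_eq zero_symfun.rep_eq one_symfun.rep_eq)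

interpretation const_sf: comm_ring_hom const_sf by (rule comm_ring_hom_const_sf)

text \<open>A factor x_i^k is split off the monomial in every possible way. For k > 0 different i
  give different factors, so nothing is counted twice.\<close>

lemma coeff_power_sum_mult:
  assumes "k > 0"
  shows "coeff_sf (power_sum k * F) m =
    (\<Sum>i | k \<le> count m i. coeff_sf F (m - replicate_mset k i))"
proof -
  let ?f = "\<lambda>i. (replicate_mset k i, m - replicate_mset k i)"
  have inj: "inj_on ?f {i. k \<le> count m i}"
    using assms by (auto simp: inj_on_def) (metis count_replicate_mset less_numeral_extra(3))
  have "coeff_sf (power_sum k * F) m =
     (\<Sum>(a, b)\<in>?f ` {i. k \<le> count m i}. coeff_sf (power_sum k) a * coeff_sf F b)"
    unfolding times_symfun.rep_eq
  proof (intro sum.mono_neutral_right finite_mset_splits)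
    show "?f ` {i. k \<le> count m i} \<subseteq> {(a, b). a + b = m}"
      by (auto simp: count_le_replicate_mset_subset_eq)
    show "\<forall>x\<in>{(a, b). a + b = m} - ?f ` {i. k \<le> count m i}.
             (case x of (a, b) \<Rightarrow> coeff_sf (power_sum k) a * coeff_sf F b) = 0"
    proof
      fix x assume x: "x \<in> {(a, b). a + b = m} - ?f ` {i. k \<le> count m i}"
      obtain a b where ab: "x = (a, b)" "a + b = m" using x by auto
      have "a \<noteq> replicate_mset k i" for i
      proof
        assume "a = replicate_mset k i"
        with ab have "x = ?f i" "k \<le> count m i" by auto
        thus False using x by blast
      qed
      thus "(case x of (a, b) \<Rightarrow> coeff_sf (power_sum k) a * coeff_sf F b) = 0"
        by (simp add: ab power_sum.rep_eq)
    qed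
  qed
  also have "\<dots> = (\<Sum>i | k \<le> count m i. coeff_sf F (m - replicate_mset k i))"
    by (subst sum.reindex[OF inj]) (auto simp: power_sum.rep_eq intro!: sum.cong)
  finally show ?thesis .
qed

lemma in_mset_if_count_ge: "0 < k \<Longrightarrow> k \<le> count m i \<Longrightarrow> i \<in># m"
  using count_greater_zero_iff[of m i] by linarith

lemma finite_count_ge: "k > 0 \<Longrightarrow> finite {i. k \<le> count m i}"
  by (rule finite_subset[of _ "set_mset m"]) (auto dest: in_mset_if_count_ge)

text \<open>Double counting of the pairs (k, i) with k between 1 and the exponent of x_i.\<close>

lemma sum_card_count_ge:
  assumes "size m \<le> n"
  shows "(\<Sum>k=1..n. card {i. k \<le> count m i}) = size m"
proof -
  have "(\<Sum>k=1..n. card {i. k \<le> count m i}) = (\<Sum>k=1..n. \<Sum>i\<in>set_mset m. if k \<le> count m i then 1 else 0)"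
  proof (rule sum.cong)
    fix k assume "k \<in> {1..n}"
    hence "{i. k \<le> count m i} = {i \<in> set_mset m. k \<le> count m i}"
      by (auto intro: in_mset_if_count_ge[of k])
    thus "card {i. k \<le> count m i} = (\<Sum>i\<in>set_mset m. if k \<le> count m i then 1 else 0)"
      by (simp add: sum.If_cases Int_def)
  qed simp
  also have "\<dots> = (\<Sum>i\<in>set_mset m. \<Sum>k=1..n. if k \<le> count m i then 1 else 0)"
    by (rule sum.swap)
  also have "\<dots> = (\<Sum>i\<in>set_mset m. count m i)"
  proof (rule sum.cong)
    fix i assume "i \<in> set_mset m"
    have "{1..n} \<inter> {k. k \<le> count m i} = {1..count m i}"
      using count_le_size[of m i] assms by auto
    thus "(\<Sum>k=1..n. if k \<le> count m i then 1 else 0) = count m i"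
      by (simp add: sum.If_cases)
  qed simp
  finally show ?thesis by (simp add: size_multiset_overloaded_eq)
qed

text \<open>At a monomial of degree n, the sum of p_k h_{n-k} counts the ways to split off some
  x_i^k with k > 0; by \<open>sum_card_count_ge\<close> there are n of them.\<close>

lemma is_omega_complete_sf: "is_omega power_sum (Abs_fps (\<lambda>n. complete_sf (int n)))"
proof -
  have "of_nat n * complete_sf (int n) = (\<Sum>k=1..n. power_sum k * complete_sf (int (n - k)))" for n
  proof (rule symfun_eqI)
    fix m
    have "coeff_sf (\<Sum>k=1..n. power_sum k * complete_sf (int (n - k))) m =
       (\<Sum>k=1..n. \<Sum>i | k \<le> count m i. if size m = n then 1 else 0)"
      unfolding coeff_sum_sf
    proof (rule sum.cong)
      fix k assume k: "k \<in> {1..n}"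
      have "coeff_sf (power_sum k * complete_sf (int (n - k))) m =
        (\<Sum>i | k \<le> count m i. coeff_sf (complete_sf (int (n - k))) (m - replicate_mset k i))"
        using k by (intro coeff_power_sum_mult) auto
      also have "\<dots> = (\<Sum>i | k \<le> count m i. if size m = n then 1 else 0)"
      proof (rule sum.cong)
        fix i assume "i \<in> {i. k \<le> count m i}"
        hence i: "replicate_mset k i \<subseteq># m" by (simp add: count_le_replicate_mset_subset_eq)
        with size_mset_mono[OF this] k
        show "coeff_sf (complete_sf (int (n - k))) (m - replicate_mset k i) = (if size m = n then 1 else 0)"
          by (auto simp: complete_sf.rep_eq size_Diff_submset)
      qed simp
      finally show "coeff_sf (power_sum k * complete_sf (int (n - k))) m =
        (\<Sum>i | k \<le> count m i. if size m = n then 1 else 0)" .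
    qed simp
    also have "\<dots> = of_nat n * (if size m = n then 1 else 0)"
    proof (cases "size m = n")
      case True
      hence "of_nat (\<Sum>k=1..n. card {i. k \<le> count m i}) = (of_nat n :: ratfun)"
        by (subst sum_card_count_ge) auto
      thus ?thesis using True by simp
    qed simp
    also have "\<dots> = coeff_sf (of_nat n * complete_sf (int n)) m"
      by (simp add: coeff_const_mult complete_sf.rep_eq flip: const_sf.hom_of_nat)
    finally show "coeff_sf (of_nat n * complete_sf (int n)) m =
       coeff_sf (\<Sum>k=1..n. power_sum k * complete_sf (int (n - k))) m" ..
  qed
  moreover have "complete_sf 0 = 1"
    by (rule symfun_eqI) (simp add: complete_sf.rep_eq one_symfun.rep_eq)
  ultimately show ?thesis by (simp add: is_omega_def)
qed

section \<open>Algebraic independence of the power sums\<close>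

definition exponents :: "nat multiset \<Rightarrow> nat multiset" where
  "exponents m = image_mset (count m) (mset_set (set_mset m))"

lemma size_exponents: "size (exponents m) = card (set_mset m)"
  by (simp add: exponents_def)

lemma exponents_add:
  assumes "i \<notin># m" "k > 0"
  shows "exponents (m + replicate_mset k i) = add_mset k (exponents m)"
proof -
  have "set_mset (m + replicate_mset k i) = insert i (set_mset m)"
    using assms by auto
  hence "exponents (m + replicate_mset k i) =
     add_mset (count (m + replicate_mset k i) i)
       (image_mset (count (m + replicate_mset k i)) (mset_set (set_mset m)))"
    using assms by (simp add: exponents_def)
  also have "count (m + replicate_mset k i) i = k"
    using assms by (simp add: not_in_iff)
  also have "image_mset (count (m + replicate_mset k i)) (mset_set (set_mset m)) = exponents m"
    unfolding exponents_def using assms by (intro image_mset_cong) auto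
  finally show ?thesis .
qed

lemma ex_exponents:
  assumes "0 \<notin># \<nu>"
  shows "\<exists>m. exponents m = \<nu>"
  using assms
proof (induction \<nu>)
  case empty
  show ?case by (rule exI[of _ "{#}"]) (simp add: exponents_def)
next
  case (add k \<nu>)
  then obtain m where "exponents m = \<nu>" by auto
  moreover obtain i where "i \<notin># m"
    using ex_new_if_finite[of "set_mset m"] by auto
  ultimately show ?case using exponents_add[of i m k] add.prems by auto
qed

text \<open>Each factor p_k contributes one x_i^k, so at most \<open>size \<nu>\<close> variables
  occur, and if that many do, their exponents are the parts of \<nu>. The coefficient is a natural
  number so that the summands in the induction cannot cancel.\<close>

lemma coeff_prod_power_sum:
  assumes "0 \<notin># \<nu>"
  shows "\<exists>n::nat. coeff_sf (\<Prod>k\<in>#\<nu>. power_sum k) m = of_nat n \<and>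
     (n \<noteq> 0 \<longrightarrow> card (set_mset m) \<le> size \<nu> \<and> (card (set_mset m) = size \<nu> \<longrightarrow> exponents m = \<nu>)) \<and>
     (exponents m = \<nu> \<longrightarrow> n \<noteq> 0)"
  using assms
proof (induction \<nu> arbitrary: m)
  case empty
  have "exponents m = {#} \<Longrightarrow> m = {#}" "exponents {#} = {#}"
    by (auto simp: exponents_def mset_set_empty_iff)
  thus ?case
    by (intro exI[of _ "if m = {#} then 1 else 0"]) (auto simp: one_symfun.rep_eq)
next
  case (add k \<nu>)
  define I where "I = {i. k \<le> count m i}"
  have k: "k > 0" using add.prems by auto
  have fin: "finite I" unfolding I_def using k by (rule finite_count_ge)
  have "\<forall>m. \<exists>n::nat. coeff_sf (\<Prod>k\<in>#\<nu>. power_sum k) m = of_nat n \<and>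
     (n \<noteq> 0 \<longrightarrow> card (set_mset m) \<le> size \<nu> \<and> (card (set_mset m) = size \<nu> \<longrightarrow> exponents m = \<nu>)) \<and>
     (exponents m = \<nu> \<longrightarrow> n \<noteq> 0)"
    using add.IH add.prems by simp
  from choice[OF this] obtain N where N':
    "\<forall>m. coeff_sf (\<Prod>k\<in>#\<nu>. power_sum k) m = of_nat (N m) \<and>
     (N m \<noteq> 0 \<longrightarrow> card (set_mset m) \<le> size \<nu> \<and> (card (set_mset m) = size \<nu> \<longrightarrow> exponents m = \<nu>)) \<and>
     (exponents m = \<nu> \<longrightarrow> N m \<noteq> 0)" by blast
  have N: "coeff_sf (\<Prod>k\<in>#\<nu>. power_sum k) m = of_nat (N m)"
    "N m \<noteq> 0 \<Longrightarrow> card (set_mset m) \<le> size \<nu>"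
    "N m \<noteq> 0 \<Longrightarrow> card (set_mset m) = size \<nu> \<Longrightarrow> exponents m = \<nu>"
    "exponents m = \<nu> \<Longrightarrow> N m \<noteq> 0" for m
    using N' by blast+
  have m_eq: "m = (m - replicate_mset k i) + replicate_mset k i" if "i \<in> I" for i
    using that by (simp add: I_def count_le_replicate_mset_subset_eq)
  let ?n = "\<Sum>i\<in>I. N (m - replicate_mset k i)"
  have "coeff_sf (\<Prod>k\<in>#add_mset k \<nu>. power_sum k) m = of_nat ?n"
    using k by (simp add: coeff_power_sum_mult N I_def)
  moreover have "card (set_mset m) \<le> size (add_mset k \<nu>) \<and>
      (card (set_mset m) = size (add_mset k \<nu>) \<longrightarrow> exponents m = add_mset k \<nu>)" if n0: "?n \<noteq> 0"
  proof -
    have "\<exists>i\<in>I. N (m - replicate_mset k i) \<noteq> 0"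
    proof (rule ccontr)
      assume "\<not> ?thesis"
      hence "?n = 0" by simp
      thus False using n0 by contradiction
    qed
    then obtain i where i: "i \<in> I" "N (m - replicate_mset k i) \<noteq> 0" by blast
    define m' where "m' = m - replicate_mset k i"
    have m: "m = m' + replicate_mset k i" unfolding m'_def by (rule m_eq[OF i(1)])
    have set_m: "set_mset m = insert i (set_mset m')" using k by (auto simp: m)
    have le: "card (set_mset m') \<le> size \<nu>" using N(2) i(2) by (simp add: m'_def)
    have "exponents m = add_mset k \<nu>" if eq: "card (set_mset m) = size (add_mset k \<nu>)"
    proof -
      \<comment> \<open>If x_i still occurred in \<open>m'\<close>, then \<open>m\<close> would have
        at most \<open>size \<nu>\<close> variables, one too few.\<close>
      have "i \<notin># m'"
        using eq le set_m by (auto simp: insert_absorb)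
      hence "card (set_mset m') = size \<nu>" using eq set_m by simp
      hence "exponents m' = \<nu>" using N(3) i(2) by (simp add: m'_def)
      thus ?thesis using exponents_add[OF \<open>i \<notin># m'\<close> k] by (simp add: m)
    qed
    moreover have "card (set_mset m) \<le> Suc (card (set_mset m'))"
      unfolding set_m by (rule card_insert_le_m1) auto
    ultimately show ?thesis using le by simp
  qed
  moreover have "?n \<noteq> 0" if e: "exponents m = add_mset k \<nu>"
  proof -
    \<comment> \<open>Some variable has exponent exactly k; removing it entirely leaves the
      exponents \<nu>, and so a nonzero summand.\<close>
    have "k \<in># exponents m" by (simp add: e)
    then obtain i where i: "i \<in># m" "count m i = k" by (auto simp: exponents_def)
    define m' where "m' = m - replicate_mset k i"
    have "i \<in> I" using i by (simp add: I_def)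
    have m: "m = m' + replicate_mset k i" unfolding m'_def by (rule m_eq[OF \<open>i \<in> I\<close>])
    have "i \<notin># m'" using i by (simp add: m'_def not_in_iff)
    hence "exponents m = add_mset k (exponents m')"
      using exponents_add[OF _ k, of i m'] m by simp
    hence "N m' \<noteq> 0" using e N(4) by simp
    thus ?thesis using fin \<open>i \<in> I\<close> by (auto simp: m'_def)
  qed
  ultimately show ?case by blast
qed

text \<open>Take \<nu> of maximal size in \<open>c\<close> and a monomial with exponents \<nu>. A
  product p_\<kappa> containing it has at least as many factors as the monomial has variables, so by
  maximality equally many, and then \<kappa> = \<nu>. The coefficient there isolates that of
  p_\<nu>.\<close>

lemma power_sums_independent:
  assumes "c \<in> pos_vars" "eval_ppoly const_sf power_sum c = 0"
  shows "c = 0"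
proof (rule ccontr)
  assume "c \<noteq> 0"
  hence "Max (size ` Poly_Mapping.keys c) \<in> size ` Poly_Mapping.keys c"
    by (intro Max_in) auto
  then obtain \<nu> where \<nu>: "\<nu> \<in> Poly_Mapping.keys c" "Max (size ` Poly_Mapping.keys c) = size \<nu>"
    by blast
  have max: "size \<kappa> \<le> size \<nu>" if "\<kappa> \<in> Poly_Mapping.keys c" for \<kappa>
    using that unfolding \<nu>(2)[symmetric] by (intro Max_ge) auto
  have pos: "0 \<notin># \<kappa>" if "\<kappa> \<in> Poly_Mapping.keys c" for \<kappa>
    using assms(1) that by (auto simp: pos_vars_def)
  obtain m where m: "exponents m = \<nu>" using ex_exponents[OF pos[OF \<nu>(1)]] by blast
  hence card: "card (set_mset m) = size \<nu>" by (metis size_exponents)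
  let ?p = "\<lambda>\<kappa>. coeff_sf (\<Prod>k\<in>#\<kappa>. power_sum k) m"
  have "0 = (\<Sum>\<kappa>\<in>Poly_Mapping.keys c. Poly_Mapping.lookup c \<kappa> * ?p \<kappa>)"
    using arg_cong[OF assms(2), of "\<lambda>F. coeff_sf F m"]
    by (simp add: eval_ppoly_def coeff_sum_sf coeff_const_mult zero_symfun.rep_eq)
  also have "\<dots> = (\<Sum>\<kappa>\<in>{\<nu>}. Poly_Mapping.lookup c \<kappa> * ?p \<kappa>)"
  proof (rule sum.mono_neutral_right)
    show "\<forall>\<kappa>\<in>Poly_Mapping.keys c - {\<nu>}. Poly_Mapping.lookup c \<kappa> * ?p \<kappa> = 0"
    proof
      fix \<kappa> assume \<kappa>: "\<kappa> \<in> Poly_Mapping.keys c - {\<nu>}"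
      obtain n :: nat where n: "?p \<kappa> = of_nat n"
        "n \<noteq> 0 \<longrightarrow> card (set_mset m) \<le> size \<kappa> \<and> (card (set_mset m) = size \<kappa> \<longrightarrow> exponents m = \<kappa>)"
        using coeff_prod_power_sum[of \<kappa> m] pos[of \<kappa>] \<kappa> by blast
      have "n = 0"
      proof (rule ccontr)
        assume "n \<noteq> 0"
        hence "exponents m = \<kappa>" using n(2) card max[of \<kappa>] \<kappa> by auto
        thus False using m \<kappa> by simp
      qed
      hence "?p \<kappa> = 0" using n(1) by simp
      thus "Poly_Mapping.lookup c \<kappa> * ?p \<kappa> = 0" by simp
    qed
  qed (use \<nu> in auto)
  finally have "?p \<nu> = 0" using \<nu>(1) by (simp add: in_keys_iff)
  moreover have "?p \<nu> \<noteq> 0"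
    using coeff_prod_power_sum[OF pos[OF \<nu>(1)], of m] m by auto
  ultimately show False by contradiction
qed

text \<open>The polynomial \<open>c\<close> is a witness and independence makes it unique, which
  resolves the definite description.\<close>

lemma power_sum_expansion_eval:
  assumes "c \<in> pos_vars"
  shows "power_sum_expansion (eval_ppoly const_sf power_sum c) = c"
proof -
  interpret ev: comm_ring_hom "eval_ppoly const_sf power_sum"
    by (intro comm_ring_hom_eval_ppoly comm_ring_hom_const_sf)
  have "c' = c" if "c' \<in> pos_vars" "eval_ppoly const_sf power_sum c = eval_ppoly const_sf power_sum c'" for c'
  proof -
    have "c' - c \<in> pos_vars"
      using that assms pos_vars_add[of c' "- c"] pos_vars_uminus[of c] by simp
    moreover have "eval_ppoly const_sf power_sum (c' - c) = 0"
      using that by (simp add: ev.hom_minus)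
    ultimately show ?thesis using power_sums_independent[of "c' - c"] by simp
  qed
  note unique = this
  show ?thesis
    unfolding power_sum_expansion_def scalar_symfun_def eval_ppoly_def[symmetric]
  proof (rule the_equality)
    show "(\<forall>\<nu>\<in>Poly_Mapping.keys c. 0 \<notin># \<nu>) \<and>
      eval_ppoly const_sf power_sum c = eval_ppoly const_sf power_sum c"
      using assms by (simp add: pos_vars_def)
  next
    fix c' assume "(\<forall>\<nu>\<in>Poly_Mapping.keys c'. 0 \<notin># \<nu>) \<and>
      eval_ppoly const_sf power_sum c = eval_ppoly const_sf power_sum c'"
    thus "c' = c" by (intro unique) (simp_all add: pos_vars_def)
  qed
qed

text \<open>This reduces plethysm to polynomial evaluation: p_k receives the value p_k[E].\<close>

lemma plethysm_eval:
  "c \<in> pos_vars \<Longrightarrow> plethysm (eval_ppoly const_sf power_sum c) E = eval_ppoly scalar (\<lambda>k. raise k E) c"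
  unfolding plethysm_def by (simp only: power_sum_expansion_eval) (simp only: eval_ppoly_def)

section \<open>Raising to a power\<close>

lemma pcompose_monom_nonzero: "k > 0 \<Longrightarrow> b \<noteq> 0 \<Longrightarrow> pcompose b (monom 1 k :: rat poly) \<noteq> 0"
  using pcompose_eq_0[of b "monom 1 k"] by (auto simp: degree_monom_eq)

text \<open>\<open>raise_q\<close> is defined on the reduced fraction; cross-multiplication
  transfers it to any representative.\<close>

lemma raise_q_Fract:
  assumes "k > 0" "b \<noteq> 0"
  shows "raise_q k (Fract a b) = Fract (pcompose a (monom 1 k)) (pcompose b (monom 1 k))"
proof -
  obtain a' b' where q: "quot_of_fract (Fract a b) = (a', b')" by fastforce
  have b': "b' \<noteq> 0" using snd_quot_of_fract_nonzero[of "Fract a b"] q by simp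
  have "Fract a' b' = Fract a b" using Fract_quot_of_fract[of "Fract a b"] q by simp
  hence "a' * b = a * b'" using assms b' by (simp add: eq_fract)
  hence "pcompose a' (monom 1 k) * pcompose b (monom 1 k) = pcompose a (monom 1 k) * pcompose b' (monom 1 k)"
    by (simp flip: pcompose_mult)
  thus ?thesis using q assms b' by (simp add: raise_q_def eq_fract pcompose_monom_nonzero)
qed

lemma field_hom_raise_q:
  assumes "k > 0"
  shows "field_hom (raise_q k)"
proof
  have ex: "\<exists>a b. b \<noteq> 0 \<and> x = Fract a b" for x :: ratfun
    by (cases x) auto
  fix x y :: ratfun
  obtain a b where x: "b \<noteq> 0" "x = Fract a b" using ex[of x] by auto
  obtain c d where y: "d \<noteq> 0" "y = Fract c d" using ex[of y] by auto
  show "raise_q k (x + y) = raise_q k x + raise_q k y"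
    using x y assms by (simp add: raise_q_Fract pcompose_monom_nonzero pcompose_add pcompose_mult)
  show "raise_q k (x * y) = raise_q k x * raise_q k y"
    using x y assms by (simp add: raise_q_Fract pcompose_monom_nonzero pcompose_mult)
  show "raise_q k 1 = 1"
    using assms by (simp add: One_fract_def raise_q_Fract pcompose_1)
qed simp

lemma qvar_power: "qvar ^ k = Fract (monom 1 k) 1"
proof (induction k)
  case (Suc k)
  hence "qvar ^ Suc k = Fract (monom 1 1 * monom 1 k) 1" by (simp add: qvar_def)
  thus ?case by (simp only: mult_monom) simp
qed (simp add: One_fract_def monom_0 flip: one_pCons)

lemma raise_q_qvar: "k > 0 \<Longrightarrow> raise_q k qvar = qvar ^ k"
proof -
  assume "k > 0"
  moreover have "pcompose (monom 1 1) (monom 1 k) = (monom 1 k :: rat poly)"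
    by (simp add: monom_Suc monom_0 pcompose_pCons)
  ultimately show ?thesis
    unfolding qvar_power by (simp add: qvar_def raise_q_Fract pcompose_1)
qed

lemma qvar_nonzero: "qvar \<noteq> 0"
  by (simp add: qvar_def Zero_fract_def eq_fract)

lemma qvar_power_neq_1:
  assumes "k > 0"
  shows "qvar ^ k \<noteq> 1"
proof
  assume "qvar ^ k = 1"
  hence "monom 1 k = (1 :: rat poly)"
    by (simp add: qvar_power One_fract_def eq_fract)
  hence "degree (monom 1 k :: rat poly) = degree (1 :: rat poly)" by (rule arg_cong)
  thus False using assms by (simp add: degree_monom_eq)
qed

lemma field_hom_power_int:
  assumes "field_hom f"
  shows "f (x powi n) = f x powi n"
proof -
  interpret field_hom f by (rule assms)
  show ?thesis by (simp add: power_int_def hom_distribs)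
qed

lemma repeat_mset_eq_replicate:
  assumes "k > 0"
  shows "repeat_mset k m = replicate_mset k i \<longleftrightarrow> m = {#i#}"
proof
  assume "repeat_mset k m = replicate_mset k i"
  hence "k * count m j = (if j = i then k else 0)" for j
    by (metis count_repeat_mset count_replicate_mset)
  hence "count m j = (if j = i then 1 else 0)" for j
    using assms by (metis mult_cancel1 mult.right_neutral mult_0_right not_gr_zero)
  thus "m = {#i#}" by (intro multiset_eqI) simp
qed (simp add: multiset_eq_iff)

lemma raise_sf_const_mult_X:
  assumes "k > 0"
  shows "raise_sf k (const_sf c * X_sf) = const_sf (raise_q k c) * power_sum k"
proof (rule symfun_eqI)
  fix m :: "nat multiset"
  let ?A = "{m'. m' \<subseteq># m \<and> repeat_mset k m' = m}"
  have X: "coeff_sf (const_sf c * X_sf) m' = (if \<exists>i. m' = {#i#} then c else 0)" for m'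
    by (simp add: coeff_const_mult X_sf_def power_sum.rep_eq)
  show "coeff_sf (raise_sf k (const_sf c * X_sf)) m = coeff_sf (const_sf (raise_q k c) * power_sum k) m"
  proof (cases "\<exists>i. m = replicate_mset k i")
    case True
    then obtain i where i: "m = replicate_mset k i" by blast
    have "?A = {{#i#}}"
      using assms by (auto simp: i repeat_mset_eq_replicate count_le_replicate_mset_subset_eq)
    hence "coeff_sf (raise_sf k (const_sf c * X_sf)) m = raise_q k c"
      by (simp add: raise_sf.rep_eq X)
    thus ?thesis using True by (simp add: coeff_const_mult power_sum.rep_eq)
  next
    case False
    have "coeff_sf (const_sf c * X_sf) m' = 0" if "m' \<in> ?A" for m'
      using False that assms repeat_mset_eq_replicate[of k m'] by (auto simp: X)
    hence "coeff_sf (raise_sf k (const_sf c * X_sf)) m = 0"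
      by (simp add: raise_sf.rep_eq)
    thus ?thesis using False by (simp add: coeff_const_mult power_sum.rep_eq)
  qed
qed

lemma raise_sf_const:
  assumes "k > 0"
  shows "raise_sf k (const_sf c) = const_sf (raise_q k c)"
proof (rule symfun_eqI)
  fix m :: "nat multiset"
  have "coeff_sf (raise_sf k (const_sf c)) m =
     (\<Sum>m' | m' \<subseteq># m \<and> repeat_mset k m' = m. if m' = {#} then raise_q k c else 0)"
    by (simp add: raise_sf.rep_eq if_distrib cong: if_cong)
  also have "\<dots> = (if m = {#} then raise_q k c else 0)"
    using finite_sub_mset[of m] by (subst sum.delta) auto
  finally show "coeff_sf (raise_sf k (const_sf c)) m = coeff_sf (const_sf (raise_q k c)) m"
    by simp
qed

lemma raise_sf_0: "raise_sf k 0 = 0"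
  by (rule symfun_eqI) (simp add: raise_sf.rep_eq zero_symfun.rep_eq)

text \<open>The function under \<open>Abs_fls\<close> vanishes below k times the subdegree of
  \<open>E\<close>, so it really defines a Laurent series.\<close>

lemma raise_fls_nth:
  fixes E :: "symfun fls"
  assumes "k > 0"
  shows "fls_nth (raise k E) n = (if int k dvd n then raise_sf k (fls_nth E (n div int k)) else 0)"
proof -
  let ?f = "\<lambda>n. if int k dvd n then raise k (fls_nth E (n div int k)) else 0"
  have "?f n = 0" if "n < int k * fls_subdegree E" for n
    using that assms raise_sf_0
    by (auto simp: raise_symfun_def elim!: dvdE)
  hence "\<forall>n<int k * fls_subdegree E. ?f n = 0" by blast
  hence "fls_nth (Abs_fls ?f) n = ?f n" for n
    using nth_Abs_fls_lower_bound[of "int k * fls_subdegree E" ?f] by simp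
  thus ?thesis by (simp add: raise_fls_def raise_symfun_def)
qed


section \<open>Power sums of X + c/z and the exponential of a multiple of z\<close>

lemma comm_ring_hom_fls_const: "comm_ring_hom (fls_const :: 'a :: comm_ring_1 \<Rightarrow> _)"
  by standard (simp_all add: fls_plus_const)

lemma comm_ring_hom_scalar_fls: "comm_ring_hom (scalar :: ratfun \<Rightarrow> symfun fls)"
proof -
  interpret c: comm_ring_hom "fls_const :: symfun \<Rightarrow> _" by (rule comm_ring_hom_fls_const)
  show ?thesis
    by standard
       (simp_all add: scalar_fls_def scalar_symfun_def const_sf.hom_add const_sf.hom_mult c.hom_add
          del: fls_const_mult_const flip: c.hom_mult)
qed

lemma raise_sf_X: "k > 0 \<Longrightarrow> raise_sf k X_sf = power_sum k"
proof -
  assume k: "k > 0"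
  interpret field_hom "raise_q k" by (rule field_hom_raise_q[OF k])
  show ?thesis using raise_sf_const_mult_X[OF k, of 1] by simp
qed

lemma raise_X_plus_z_inverse:
  assumes "k > 0"
  shows "raise k (fls_const X_sf + scalar c * fls_X_inv) =
    fls_const (power_sum k) + scalar (raise_q k c) * fls_X_inv ^ k"
proof (rule fls_eqI)
  fix n
  define E where "E = fls_const X_sf + scalar c * fls_X_inv"
  have nth: "fls_nth E j =
     (if j = 0 then X_sf else if j = -1 then const_sf c else 0)" for j
    by (simp add: E_def scalar_fls_def scalar_symfun_def)
  have rhs: "fls_nth (fls_const (power_sum k) + scalar (raise_q k c) * fls_X_inv ^ k) n =
     (if n = 0 then power_sum k else if n = - int k then const_sf (raise_q k c) else 0)"
    using assms by (simp add: scalar_fls_def scalar_symfun_def)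
  show "fls_nth (raise k (fls_const X_sf + scalar c * fls_X_inv)) n =
    fls_nth (fls_const (power_sum k) + scalar (raise_q k c) * fls_X_inv ^ k) n"
  proof (cases "int k dvd n")
    case True
    then obtain j where n: "n = int k * j" by (elim dvdE)
    have "n = - int k \<longleftrightarrow> j = -1"
      using assms by (metis n mult_cancel_left mult_minus1_right of_nat_0_eq_iff not_gr_zero)
    thus ?thesis using assms unfolding rhs E_def[symmetric]
      by (simp add: raise_fls_nth nth n raise_sf_X raise_sf_const raise_sf_0)
  next
    case False
    thus ?thesis using assms unfolding rhs E_def[symmetric] by (auto simp: raise_fls_nth)
  qed
qed

text \<open>The exponent is the sum of p_n[E]/n with p_n[E] a multiple of z^n. A power series
  \<open>G\<close> is supplied so that Newton's recursion can be applied to it.\<close>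

lemma plethystic_exp_linear:
  obtains G where "plethystic_exp (- (fls_X * scalar c * fls_const X_sf)) = fps_to_fls G"
    and "is_omega (\<lambda>k. const_sf (- raise_q k c) * power_sum k) G"
proof -
  define E where "E = - (fls_X * scalar c * fls_const X_sf)"
  let ?b = "Abs_fps (\<lambda>n. \<Sum>k=1..n. scalar (1 / of_nat k) * fls_nth (raise k E) (int n))"
  let ?G = "fps_compose (Abs_fps (\<lambda>n. scalar (1 / of_nat (fact n)) :: symfun)) ?b"
  have nth: "fls_nth E j = (if j = 1 then const_sf (- c) * X_sf else 0)" for j
    by (simp add: E_def scalar_fls_def scalar_symfun_def const_sf.hom_uminus mult.assoc fls_X_times_conv_shift)
  have b: "fps_nth ?b n = const_sf (1 / of_nat n) * (const_sf (- raise_q n c) * power_sum n)"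
    if "n > 0" for n
  proof -
    interpret field_hom "raise_q n" by (rule field_hom_raise_q[OF that])
    \<comment> \<open>\<open>raise k E\<close> is concentrated in degree k, so only k = n
      contributes.\<close>
    have "(\<Sum>k=1..n. scalar (1 / of_nat k) * fls_nth (raise k E) (int n)) =
          (\<Sum>k\<in>{n}. scalar (1 / of_nat k) * fls_nth (raise k E) (int n))"
    proof (rule sum.mono_neutral_right)
      show "\<forall>k\<in>{1..n} - {n}. scalar (1 / of_nat k) * fls_nth (raise k E) (int n) = 0"
      proof
        fix k assume k: "k \<in> {1..n} - {n}"
        have "fls_nth (raise k E) (int n) = 0"
        proof (cases "int k dvd int n")
          case True
          then obtain j where j: "int n = int k * j" by (elim dvdE)
          hence "j \<noteq> 1" using k by auto
          thus ?thesis using k by (simp add: raise_fls_nth nth j raise_sf_0)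
        qed (use k in \<open>simp add: raise_fls_nth\<close>)
        thus "scalar (1 / of_nat k) * fls_nth (raise k E) (int n) = 0" by simp
      qed
    qed (use that in auto)
    thus ?thesis using that
      by (simp add: raise_fls_nth nth raise_sf_const_mult_X scalar_symfun_def hom_uminus)
  qed
  have "is_omega (\<lambda>n. of_nat n * fps_nth ?b n) ?G"
  proof (rule is_omega_compose_exp)
    show "of_nat (Suc n) * (scalar (1 / of_nat (fact (Suc n))) :: symfun) = scalar (1 / of_nat (fact n))" for n
    proof -
      have "(of_nat (fact (Suc n)) :: ratfun) = of_nat (Suc n) * of_nat (fact n)"
        by (simp only: fact_Suc of_nat_mult of_nat_id)
      moreover have "(of_nat (Suc n) :: ratfun) \<noteq> 0" by (simp del: of_nat_Suc)
      ultimately have "of_nat (Suc n) * (1 / of_nat (fact (Suc n))) = (1 / of_nat (fact n) :: ratfun)"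
        by (simp del: of_nat_Suc of_nat_fact)
      thus ?thesis
        unfolding scalar_symfun_def const_sf.hom_of_nat[symmetric] const_sf.hom_mult[symmetric] by simp
    qed
  qed (simp_all add: scalar_symfun_def)
  hence "is_omega (\<lambda>k. const_sf (- raise_q k c) * power_sum k) ?G"
  proof (rule is_omega_cong)
    fix k :: nat assume k: "k > 0"
    have "of_nat k * const_sf (1 / of_nat k) = 1"
      unfolding const_sf.hom_of_nat[symmetric] const_sf.hom_mult[symmetric] using k by simp
    thus "of_nat k * fps_nth ?b k = const_sf (- raise_q k c) * power_sum k"
      unfolding b[OF k] by (simp flip: mult.assoc)
  qed
  thus thesis using that[of ?G] by (simp add: plethystic_exp_def E_def)
qed

section \<open>Plethysm of Schur functions\<close>

lemma (in comm_ring_hom) hom_det_mat: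
  "hom (det (mat n n (\<lambda>(i, j). f i j))) = det (mat n n (\<lambda>(i, j). hom (f i j)))"
  unfolding hom_det[symmetric] by (rule arg_cong[of _ _ det], rule eq_matI) auto

lemma hom_eval_ppoly:
  assumes "comm_ring_hom f"
  shows "f (eval_ppoly \<sigma> x c) = eval_ppoly (\<lambda>a. f (\<sigma> a)) (\<lambda>k. f (x k)) c"
proof -
  interpret comm_ring_hom f by (rule assms)
  show ?thesis by (simp add: eval_ppoly_def hom_sum hom_mult hom_prod_mset multiset.map_comp o_def)
qed

lemma eval_ppoly_cong:
  assumes "c \<in> pos_vars" "\<And>k. k > 0 \<Longrightarrow> x k = x' k"
  shows "eval_ppoly \<sigma> x c = eval_ppoly \<sigma> x' c"
proof -
  have "(\<Prod>k\<in>#\<nu>. x k) = (\<Prod>k\<in>#\<nu>. x' k)" if "\<nu> \<in> Poly_Mapping.keys c" for \<nu>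
  proof (rule arg_cong[of _ _ prod_mset], rule image_mset_cong)
    fix k assume "k \<in># \<nu>"
    moreover have "0 \<notin># \<nu>" using assms(1) that by (simp add: pos_vars_def)
    ultimately show "x k = x' k" by (intro assms(2)) (metis not_gr_zero)
  qed
  thus ?thesis by (simp add: eval_ppoly_def)
qed

lemma pos_vars_eval:
  assumes "\<And>a. \<sigma> a \<in> pos_vars" "\<And>k. k > 0 \<Longrightarrow> x k \<in> pos_vars" "c \<in> pos_vars"
  shows "eval_ppoly \<sigma> x c \<in> pos_vars"
proof -
  have "(\<Prod>k\<in>#\<nu>. x k) \<in> pos_vars" if "0 \<notin># \<nu>" for \<nu>
    using that by (induction \<nu>) (auto intro!: pos_vars_mult assms simp: pos_vars_1)
  thus ?thesis using assms(1,3)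
    unfolding eval_ppoly_def by (intro pos_vars_sum pos_vars_mult) (auto simp: pos_vars_def)
qed

lemma eval_ppoly_single0: "comm_ring_hom \<sigma> \<Longrightarrow> eval_ppoly \<sigma> x (Poly_Mapping.single 0 a) = \<sigma> a"
proof -
  assume "comm_ring_hom \<sigma>"
  then interpret comm_ring_hom \<sigma> .
  show ?thesis by (simp add: eval_ppoly_def)
qed

definition hpoly_int :: "int \<Rightarrow> ppoly" where
  "hpoly_int n = (if n < 0 then 0 else hpoly (nat n))"

definition schur_ppoly :: "nat list \<Rightarrow> ppoly" where
  "schur_ppoly \<mu> = det (mat (length \<mu>) (length \<mu>) (\<lambda>(i, j). hpoly_int (int (\<mu> ! i) - int i + int j)))"

lemma pos_vars_schur_ppoly: "schur_ppoly \<mu> \<in> pos_vars"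
  unfolding schur_ppoly_def
  by (rule pos_vars_det) (simp add: hpoly_int_def pos_vars_0 pos_vars_hpoly)

text \<open>\<open>hpoly\<close> is the generic solution of Newton's recursion; specialising the p_k
  gives the solution for any given values.\<close>

lemma is_omega_eval_hpoly:
  assumes "comm_ring_hom \<sigma>"
  shows "is_omega x (Abs_fps (\<lambda>n. eval_ppoly \<sigma> x (hpoly n)))"
  using is_omega_hom[OF comm_ring_hom_eval_ppoly[OF assms] is_omega_hpoly, of x]
  by (simp add: eval_ppoly_pvar[OF assms])

lemma of_nat_inverse_hom:
  assumes "comm_ring_hom (\<sigma> :: ratfun \<Rightarrow> 'a :: comm_ring_1)" "n > 0"
  shows "\<exists>r :: 'a. r * of_nat n = 1"
proof
  interpret comm_ring_hom \<sigma> by (rule assms)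
  show "\<sigma> (1 / of_nat n) * of_nat n = 1"
    unfolding hom_of_nat[symmetric] hom_mult[symmetric] using assms(2) by simp
qed

lemma eval_hpoly_int_power_sum: "eval_ppoly const_sf power_sum (hpoly_int n) = complete_sf n"
proof (cases "n < 0")
  case True
  thus ?thesis
    by (intro symfun_eqI) (auto simp: hpoly_int_def eval_ppoly_def complete_sf.rep_eq zero_symfun.rep_eq)
next
  case False
  have "Abs_fps (\<lambda>n. eval_ppoly const_sf power_sum (hpoly n)) = Abs_fps (\<lambda>n. complete_sf (int n))"
    by (rule is_omega_unique[OF is_omega_eval_hpoly is_omega_complete_sf])
       (auto intro: of_nat_inverse_hom comm_ring_hom_const_sf)
  hence "eval_ppoly const_sf power_sum (hpoly (nat n)) = complete_sf (int (nat n))"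
    by (simp add: fps_eq_iff)
  thus ?thesis using False by (simp add: hpoly_int_def)
qed

lemma eval_schur_ppoly:
  assumes "comm_ring_hom \<sigma>"
  shows "eval_ppoly \<sigma> x (schur_ppoly \<mu>) =
    det (mat (length \<mu>) (length \<mu>) (\<lambda>(i, j). eval_ppoly \<sigma> x (hpoly_int (int (\<mu> ! i) - int i + int j))))"
proof -
  interpret comm_ring_hom "eval_ppoly \<sigma> x" by (rule comm_ring_hom_eval_ppoly[OF assms])
  show ?thesis unfolding schur_ppoly_def by (rule hom_det_mat)
qed

lemma schur_eq_eval: "schur \<mu> = eval_ppoly const_sf power_sum (schur_ppoly \<mu>)"
  unfolding eval_schur_ppoly[OF comm_ring_hom_const_sf] schur_def eval_hpoly_int_power_sum ..

lemma plethysm_schur_scaled: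
  "plethysm (schur \<mu>) (X_sf * scalar r) =
   eval_ppoly const_sf (\<lambda>k. const_sf (raise_q k r) * power_sum k) (schur_ppoly \<mu>)"
  unfolding schur_eq_eval plethysm_eval[OF pos_vars_schur_ppoly] scalar_symfun_def
  by (rule eval_ppoly_cong[OF pos_vars_schur_ppoly])
     (simp add: raise_symfun_def raise_sf_const_mult_X mult.commute[of X_sf])

text \<open>The polynomial \<open>c\<close> of the proof is the power sum expansion of s_\<mu>[rX],
  obtained by replacing p_k by p_k[r] p_k. The outer plethysm evaluates it at p_k[E].\<close>

lemma plethysm_plethysm_schur_scaled:
  fixes E :: "'a :: plethystic"
  assumes hom: "comm_ring_hom (scalar :: ratfun \<Rightarrow> 'a)"
  shows "plethysm (plethysm (schur \<mu>) (X_sf * scalar r)) E =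
    eval_ppoly scalar (\<lambda>k. scalar (raise_q k r) * raise k E) (schur_ppoly \<mu>)"
proof -
  define x where "x k = Poly_Mapping.single 0 (raise_q k r) * pvar k" for k
  define c where "c = eval_ppoly (Poly_Mapping.single 0) x (schur_ppoly \<mu>)"
  have c: "c \<in> pos_vars" unfolding c_def x_def
    by (intro pos_vars_eval pos_vars_schur_ppoly pos_vars_mult pos_vars_pvar pos_vars_single) simp_all
  have eval_c: "eval_ppoly \<sigma> p c = eval_ppoly \<sigma> (\<lambda>k. \<sigma> (raise_q k r) * p k) (schur_ppoly \<mu>)"
    if \<sigma>: "comm_ring_hom \<sigma>" for \<sigma> :: "ratfun \<Rightarrow> 'b :: comm_ring_1" and p
  proof -
    interpret f: comm_ring_hom "eval_ppoly \<sigma> p" by (rule comm_ring_hom_eval_ppoly[OF \<sigma>])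
    show ?thesis
      unfolding c_def hom_eval_ppoly[OF f.comm_ring_hom_axioms] x_def f.hom_mult
        eval_ppoly_single0[OF \<sigma>] eval_ppoly_pvar[OF \<sigma>] ..
  qed
  show ?thesis
    unfolding plethysm_schur_scaled eval_c[OF comm_ring_hom_const_sf, symmetric]
    by (simp only: plethysm_eval[OF c] eval_c[OF hom])
qed

section \<open>The arguments of the operator in terms of Y, Q and w\<close>

lemma qvar_power_powi: "(qvar ^ k) powi u = (qvar powi u) ^ k"
  by (metis power_int_power power_int_power' mult.commute)

text \<open>From (1 - 1/q)/(1-q) = -1/q: divided by 1-q, the shift M[u]_q/z becomes (Q-1)w. This is
  p_k of that identity without the power of z.\<close>

lemma raise_q_shift:
  assumes "k > 0"
  shows "raise_q k (1 / (1 - qvar)) * raise_q k (M_qt * q_int qvar u) =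
    ((qvar powi u) ^ k - 1) * (1 / qvar) ^ k"
proof -
  interpret field_hom "raise_q k" by (rule field_hom_raise_q[OF assms])
  have "1 / (1 - x) * ((1 - 1 / x) * (1 - x) * ((1 - p) / (1 - x))) = (p - 1) * (1 / x)"
    if "x \<noteq> 0" "1 - x \<noteq> 0" for x p :: ratfun
  proof -
    have "1 - 1 / x = - ((1 - x) / x)" using that(1) by (simp add: diff_divide_distrib)
    moreover have "1 / a * (- (a / x) * a * ((1 - p) / a)) = (p - 1) * (1 / x)" if "a \<noteq> 0" for a
      using that \<open>x \<noteq> 0\<close> by (simp add: field_simps)
    ultimately show ?thesis using that(2) by (simp only:)
  qed
  moreover have "qvar ^ k \<noteq> 0" "1 - qvar ^ k \<noteq> 0"
    using qvar_nonzero qvar_power_neq_1[OF assms] by simp_all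
  ultimately have "1 / (1 - qvar ^ k) * ((1 - 1 / qvar ^ k) * (1 - qvar ^ k) * ((1 - (qvar powi u) ^ k) / (1 - qvar ^ k)))
      = ((qvar powi u) ^ k - 1) * (1 / qvar ^ k)"
    by blast
  thus ?thesis
    by (simp only: M_qt_def q_int_def tvar_def hom_distribs hom_one field_hom_power_int[OF field_hom_raise_q[OF assms]]
        raise_q_qvar[OF assms] qvar_power_powi power_one_over)
qed

text \<open>From q(1 - 1/q) = -(1-q): the exponent -z[u]_t X equals qz(1 - 1/Q)Y.\<close>

lemma raise_q_exponent:
  assumes "k > 0"
  shows "(1 / qvar) ^ k * - raise_q k (q_int tvar u) =
    (1 - (qvar powi (- u)) ^ k) * raise_q k (1 / (1 - qvar))"
proof -
  interpret field_hom "raise_q k" by (rule field_hom_raise_q[OF assms])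
  have 1: "1 - qvar ^ k \<noteq> 0" using qvar_power_neq_1[OF assms] by simp
  have 2: "1 - 1 / qvar ^ k = - ((1 - qvar ^ k) / qvar ^ k)"
    using qvar_nonzero by (simp add: diff_divide_distrib)
  have 3: "(1 / qvar ^ k) powi u = (qvar powi (- u)) ^ k"
    by (simp add: power_int_divide_distrib qvar_power_powi power_int_minus power_int_inverse power_inverse divide_inverse)
  show ?thesis using 1 qvar_nonzero
    by (simp add: q_int_def tvar_def hom_distribs field_hom_power_int[OF field_hom_raise_q[OF assms]]
        raise_q_qvar[OF assms] 3 power_one_over 2)
qed

section \<open>The eigenvalue of D_{u,0} on s_\<mu>[X/(1-q)]\<close>

theorem theoremI5:
  fixes u :: int and \<mu> :: "nat list"
  assumes "u \<ge> 1" and "is_partition \<mu>"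
  shows "D_op u 0 (plethysm (schur \<mu>) (X_sf * scalar (1 / (1 - qvar)))) =
         scalar (1 - (1 - qvar powi (- u)) * (1 - qvar powi u) * B_stat \<mu> (qvar powi u) (qvar powi (- u)))
         * plethysm (schur \<mu>) (X_sf * scalar (1 / (1 - qvar)))"
proof -
  define r where "r = 1 / (1 - qvar)"
  define l where "l = length \<mu>"
  define qu where "qu = qvar powi u"
  define qu' where "qu' = qvar powi (- u)"
  have qu: "qu * qu' = 1" "qu' * qu = 1"
    using qvar_nonzero by (simp_all add: qu_def qu'_def power_int_minus)
  define Q where "Q = const_sf qu"
  define R where "R = const_sf qu'"
  \<comment> \<open>\<open>y k\<close> is p_k[Y] and \<open>h n\<close> is h_n[Y]; below,
    \<open>z k\<close> and \<open>a n\<close> play these roles for E/(1-q), that is, for Y +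
    (Q-1)w.\<close>
  define y where "y k = const_sf (raise_q k r) * power_sum k" for k
  define h where "h n = eval_ppoly const_sf y (hpoly_int n)" for n
  define d where "d = M_qt * q_int qvar u"
  define E where "E = fls_const X_sf + scalar d * fls_X_inv"
  define z where "z k = scalar (raise_q k r) * raise k E" for k
  define a where "a n = eval_ppoly scalar z (hpoly_int n)" for n
  define w :: "symfun fls" where "w = scalar (1 / qvar) * fls_X_inv"
  define e where "e k = (if k = 0 then 1 else (Q - 1) * Q ^ (k - 1))" for k
  obtain G where G: "plethystic_exp (- (fls_X * scalar (q_int tvar u) * fls_const X_sf)) = fps_to_fls G"
    "is_omega (\<lambda>k. const_sf (- raise_q k (q_int tvar u)) * power_sum k) G"
    by (rule plethystic_exp_linear)
  \<comment> \<open>w^k = q^{-k} z^{-k} meets the coefficient of z^k in \<open>G\<close>, so this is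
    the value of \<open>L\<close> at w^k.\<close>
  define \<gamma> where "\<gamma> k = const_sf (1 / qvar) ^ k * fps_nth G k" for k
  define L where "L f = fls_nth (f * fps_to_fls G) 0" for f :: "symfun fls"

  interpret s: comm_ring_hom "scalar :: ratfun \<Rightarrow> symfun fls" by (rule comm_ring_hom_scalar_fls)
  interpret \<phi>: comm_ring_hom "fls_const :: symfun \<Rightarrow> _" by (rule comm_ring_hom_fls_const)

  have scalar_fls: "scalar c = fls_const (const_sf c)" for c
    by (simp add: scalar_fls_def scalar_symfun_def)
  have h_neg: "h n = 0" if "n < 0" for n
    using that by (simp add: h_def hpoly_int_def eval_ppoly_def)
  have omega_h: "is_omega y (Abs_fps (\<lambda>n. h (int n)))"
    using is_omega_eval_hpoly[OF comm_ring_hom_const_sf, of y] by (simp add: h_def hpoly_int_def)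
  have omega_a: "is_omega z (Abs_fps (\<lambda>n. a (int n)))"
    using is_omega_eval_hpoly[OF comm_ring_hom_scalar_fls, of z] by (simp add: a_def hpoly_int_def)

  have z_eq: "z k = (fls_const Q ^ k - 1) * w ^ k + fls_const (y k)" if "k > 0" for k
  proof -
    have "z k = fls_const (y k) + scalar (raise_q k r * raise_q k d) * fls_X_inv ^ k"
      unfolding z_def E_def raise_X_plus_z_inverse[OF that]
      by (simp add: y_def scalar_fls const_sf.hom_mult algebra_simps flip: fls_const_mult_const)
    also have "raise_q k r * raise_q k d = (qu ^ k - 1) * (1 / qvar) ^ k"
      unfolding r_def d_def qu_def by (rule raise_q_shift[OF that])
    also have "scalar \<dots> * fls_X_inv ^ k = (fls_const Q ^ k - 1) * w ^ k"
      unfolding Q_def w_def scalar_fls[symmetric] power_mult_distrib s.hom_mult s.hom_power s.hom_minus s.hom_one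
      by (simp only: mult.assoc)
    finally show ?thesis by (simp add: add.commute)
  qed
  \<comment> \<open>Multiplicativity of Omega at Y + (Q-1)w; uniqueness then gives
    \<open>a n\<close> as a convolution of \<open>e\<close> and \<open>h\<close>.\<close>
  have "is_omega (\<lambda>k. (fls_const Q ^ k - 1) * w ^ k + fls_const (y k))
      (Abs_fps (\<lambda>k. fls_const (e k) * w ^ k) * Abs_fps (\<lambda>n. fls_const (h (int n))))"
  proof (rule is_omega_mult)
    show "is_omega (\<lambda>k. (fls_const Q ^ k - 1) * w ^ k) (Abs_fps (\<lambda>k. fls_const (e k) * w ^ k))"
      by (rule is_omega_geometric)
         (simp add: e_def \<phi>.hom_mult \<phi>.hom_minus \<phi>.hom_power del: fls_const_mult_const)
    show "is_omega (\<lambda>k. fls_const (y k)) (Abs_fps (\<lambda>n. fls_const (h (int n))))"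
      using is_omega_hom[OF comm_ring_hom_fls_const omega_h] by simp
  qed
  hence "is_omega z (Abs_fps (\<lambda>k. fls_const (e k) * w ^ k) * Abs_fps (\<lambda>n. fls_const (h (int n))))"
    by (rule is_omega_cong) (simp add: z_eq)
  with omega_a have "Abs_fps (\<lambda>n. a (int n)) =
      Abs_fps (\<lambda>k. fls_const (e k) * w ^ k) * Abs_fps (\<lambda>n. fls_const (h (int n)))"
    by (rule is_omega_unique) (rule of_nat_inverse_hom[OF comm_ring_hom_scalar_fls])
  hence "a (int n) = fps_nth (Abs_fps (\<lambda>k. fls_const (e k) * w ^ k) * Abs_fps (\<lambda>n. fls_const (h (int n)))) n" for n
    by (metis fps_nth_Abs_fps)
  also have "\<dots> n = (\<Sum>k\<le>n. fls_const (e k) * w ^ k * fls_const (h (int n - int k)))" for n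
    unfolding fps_mult_nth atMost_atLeast0 by (rule sum.cong) (auto simp: of_nat_diff)
  finally have a_nonneg: "a (int n) = (\<Sum>k\<le>n. fls_const (e k) * w ^ k * fls_const (h (int n - int k)))" for n .
  have a_eq: "a n = (\<Sum>k\<le>nat n. fls_const (e k) * w ^ k * fls_const (h (n - int k)))" for n
  proof (cases "n < 0")
    case True
    thus ?thesis by (simp add: h_neg a_def hpoly_int_def eval_ppoly_def)
  next
    case False
    thus ?thesis using a_nonneg[of "nat n"] by simp
  qed

  \<comment> \<open>The series of \<gamma> is G(x/q) = Omega[x(1-R)Y].\<close>
  have "is_omega (\<lambda>k. (1 - R ^ k) * y k) (Abs_fps \<gamma>)"
  proof (rule is_omega_cong)
    show "is_omega (\<lambda>k. const_sf (1 / qvar) ^ k * (const_sf (- raise_q k (q_int tvar u)) * power_sum k)) (Abs_fps \<gamma>)"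
      using is_omega_dilate[OF G(2), of "const_sf (1 / qvar)"] by (simp add: \<gamma>_def[abs_def])
  next
    fix k :: nat assume "k > 0"
    from raise_q_exponent[OF this, of u]
    have "const_sf (1 / qvar) ^ k * const_sf (- raise_q k (q_int tvar u)) = (1 - R ^ k) * const_sf (raise_q k r)"
      unfolding R_def r_def qu'_def by (simp flip: const_sf.hom_mult const_sf.hom_power const_sf.hom_minus const_sf.hom_one)
    thus "const_sf (1 / qvar) ^ k * (const_sf (- raise_q k (q_int tvar u)) * power_sum k) = (1 - R ^ k) * y k"
      by (simp add: y_def flip: mult.assoc)
  qed
  \<comment> \<open>Replacing x by Qx gives Omega[x(Q-1)Y]; its product with h(x) = Omega[xY] is
    Omega[xQY] = h(Qx).\<close>
  from is_omega_mult[OF is_omega_dilate[OF this, of Q] omega_h]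
  have "is_omega (\<lambda>k. Q ^ k * ((1 - R ^ k) * y k) + y k)
      (Abs_fps (\<lambda>n. Q ^ n * \<gamma> n) * Abs_fps (\<lambda>n. h (int n)))"
    unfolding fps_nth_Abs_fps .
  hence "is_omega (\<lambda>k. Q ^ k * y k) (Abs_fps (\<lambda>n. Q ^ n * \<gamma> n) * Abs_fps (\<lambda>n. h (int n)))"
  proof (rule is_omega_cong)
    fix k :: nat
    have "Q ^ k * R ^ k = 1"
      unfolding Q_def R_def power_mult_distrib[symmetric] const_sf.hom_mult[symmetric] qu by simp
    thus "Q ^ k * ((1 - R ^ k) * y k) + y k = Q ^ k * y k"
      by (simp add: algebra_simps flip: mult.assoc)
  qed
  moreover have "is_omega (\<lambda>k. Q ^ k * y k) (Abs_fps (\<lambda>n. Q ^ n * h (int n)))"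
    using is_omega_dilate[OF omega_h, of Q] by simp
  ultimately have "Abs_fps (\<lambda>n. Q ^ n * \<gamma> n) * Abs_fps (\<lambda>n. h (int n)) = Abs_fps (\<lambda>n. Q ^ n * h (int n))"
    by (rule is_omega_unique) (rule of_nat_inverse_hom[OF comm_ring_hom_const_sf])
  hence "Q ^ n * h (int n) = fps_nth (Abs_fps (\<lambda>n. Q ^ n * \<gamma> n) * Abs_fps (\<lambda>n. h (int n))) n" for n
    by simp
  also have "\<dots> n = (\<Sum>k\<le>n. \<gamma> k * Q ^ k * h (int n - int k))" for n
    unfolding fps_mult_nth atMost_atLeast0 by (rule sum.cong) (auto simp: of_nat_diff mult_ac)
  finally have h_dilate: "Q ^ n * h (int n) = (\<Sum>k\<le>n. \<gamma> k * Q ^ k * h (int n - int k))" for n .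

  have det: "L (det (mat l l (\<lambda>(i, j). a (int (\<mu> ! i) - int i + int j)))) =
    (1 + (1 - R) * (\<Sum>i<l. R ^ i * (Q ^ (\<mu> ! i) - 1))) *
    det (mat l l (\<lambda>(i, j). h (int (\<mu> ! i) - int i + int j)))"
  proof (rule det_eigenvector[OF comm_ring_hom_fls_const, where w = w and \<gamma> = \<gamma> and e = e])
    show "L (x + x') = L x + L x'" for x x' by (simp add: L_def distrib_right)
    show "L (fls_const c * x) = c * L x" for c x by (simp add: L_def mult.assoc)
    show "L (w ^ k) = \<gamma> k" for k
    proof -
      have "w ^ k * fps_to_fls G = fls_const (const_sf (1 / qvar) ^ k) * (fls_X_inv ^ k * fps_to_fls G)"
        unfolding w_def scalar_fls power_mult_distrib \<phi>.hom_power by (simp only: mult.assoc)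
      thus ?thesis by (simp add: L_def \<gamma>_def fls_X_inv_power_times_conv_shift)
    qed
    show "\<gamma> 0 = 1" using G(2) by (simp add: \<gamma>_def is_omega_def)
    show "Q * R = 1" unfolding Q_def R_def const_sf.hom_mult[symmetric] qu by simp
    show "Q ^ n * h (int n) = (\<Sum>k\<le>n. \<gamma> k * Q ^ k * h (int n - int k))" for n by (rule h_dilate)
    show "a n = (\<Sum>k\<le>nat n. fls_const (e k) * w ^ k * fls_const (h (n - int k)))" for n by (rule a_eq)
  qed (simp_all add: h_neg e_def)

  have F: "plethysm (schur \<mu>) (X_sf * scalar r) = det (mat l l (\<lambda>(i, j). h (int (\<mu> ! i) - int i + int j)))"
    unfolding plethysm_schur_scaled y_def[symmetric]
      eval_schur_ppoly[OF comm_ring_hom_const_sf] h_def l_def ..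
  have "plethysm (plethysm (schur \<mu>) (X_sf * scalar r)) E =
      det (mat l l (\<lambda>(i, j). a (int (\<mu> ! i) - int i + int j)))"
    unfolding plethysm_plethysm_schur_scaled[OF comm_ring_hom_scalar_fls] z_def[symmetric]
      eval_schur_ppoly[OF comm_ring_hom_scalar_fls] a_def l_def ..
  hence "D_op u 0 (plethysm (schur \<mu>) (X_sf * scalar r)) =
      L (det (mat l l (\<lambda>(i, j). a (int (\<mu> ! i) - int i + int j))))"
    by (simp add: D_op_def L_def G(1) flip: E_def d_def)
  also have "\<dots> = (1 + (1 - R) * (\<Sum>i<l. R ^ i * (Q ^ (\<mu> ! i) - 1))) * plethysm (schur \<mu>) (X_sf * scalar r)"
    unfolding det F ..
  also have "1 + (1 - R) * (\<Sum>i<l. R ^ i * (Q ^ (\<mu> ! i) - 1)) =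
      scalar (1 + (1 - qu') * (\<Sum>i<l. qu' ^ i * (qu ^ (\<mu> ! i) - 1)))"
    by (simp add: scalar_symfun_def Q_def R_def const_sf.hom_add const_sf.hom_mult const_sf.hom_minus
        const_sf.hom_sum const_sf.hom_power)
  also have "1 + (1 - qu') * (\<Sum>i<l. qu' ^ i * (qu ^ (\<mu> ! i) - 1)) =
      1 - (1 - qu') * (1 - qu) * B_stat \<mu> qu qu'"
  proof -
    \<comment> \<open>Each row of \<open>B_stat\<close> is a geometric sum, which the factor 1 - Q
      telescopes.\<close>
    have "(1 - qu) * B_stat \<mu> qu qu' = (\<Sum>i<l. qu' ^ i * ((1 - qu) * (\<Sum>j<\<mu> ! i. qu ^ j)))"
      by (simp add: B_stat_def l_def sum_distrib_left mult_ac)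
    also have "\<dots> = (\<Sum>i<l. qu' ^ i * (1 - qu ^ (\<mu> ! i)))"
      by (simp add: one_diff_power_eq)
    also have "\<dots> = - (\<Sum>i<l. qu' ^ i * (qu ^ (\<mu> ! i) - 1))"
      by (simp add: sum_negf[symmetric] algebra_simps)
    finally show ?thesis by (simp add: mult.assoc)
  qed
  finally show ?thesis by (simp add: r_def qu_def qu'_def)
qed

end
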